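(* Let $m>0$, let $a\in H^1(\mathbb R)\cap L^\infty(\mathbb R)$ be real-valued, and let $$\mathcal K=\{\delta\in H^1(\mathbb R)\ \text{real-valued}:\ |\delta(t)|\le\pi/2\ \text{for a.e. }t\}.$$ The phase functional $\mathcal E_a$ (defined in the context) attains its minimum on $\mathcal K$. If $$a'(\cosh(2a)-1)\not\equiv0,$$ then every minimizer on $\mathcal K$ is nonzero and its energy is strictly smaller than the positive-lift energy $\mathcal E_a[0]$. If a minimizer $\delta_*$ on $\mathcal K$ satisfies $\|\delta_*\|_\infty<\pi/2$, then it is a weak solution of $$\delta''+2ma'\cosh(2a)-2m^2\cosh(2a)\sin(2\delta)-2ma'\cos(2\delta)=0.$$
   Context: For a real-valued phase $\delta\in H^1_{\rm loc}(\mathbb R)$, $$\mathcal E_a[\delta]=2\int_{\mathbb R}\Big[(\delta'+m\sinh(2a))^2+\big(m\cosh(2a)\cos(2\delta)-a'\sin(2\delta)-m\big)^2+\big(m\cosh(2a)\sin(2\delta)+a'\cos(2\delta)\big)^2\Big]dt.$$ "$\not\equiv0$" means not equal to $0$ almost everywhere. *)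

theory Defs
  imports "HOL-Probability.Essential_Supremum"
begin

(* Elements of the function spaces below are represented by Lebesgue measurable functions on the
   real line, without passing to classes modulo a.e. equality. *)

definition test_functions :: "(real \<Rightarrow> real) set" where
  "test_functions =
     {\<phi>. (\<forall>n. ((deriv ^^ n) \<phi>) differentiable_on UNIV) \<and> compact (closure {t. \<phi> t \<noteq> 0})}"

definition locally_integrable :: "(real \<Rightarrow> real) \<Rightarrow> bool" where
  "locally_integrable u \<longleftrightarrow> (\<forall>R. set_integrable lebesgue {-R..R} u)"

definition has_weak_deriv :: "(real \<Rightarrow> real) \<Rightarrow> (real \<Rightarrow> real) \<Rightarrow> bool" where
  "has_weak_deriv u g \<longleftrightarrow>
     locally_integrable u \<and> locally_integrable g \<and>
     (\<forall>\<phi>\<in>test_functions.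
        (LINT t|lebesgue. u t * deriv \<phi> t) = - (LINT t|lebesgue. g t * \<phi> t))"

(* The weak derivative is unique only up to null sets; this picks one representative, and every
   use below depends only on its a.e. class. *)
definition weak_deriv :: "(real \<Rightarrow> real) \<Rightarrow> real \<Rightarrow> real" where
  "weak_deriv u = (SOME g. has_weak_deriv u g)"

lemma has_weak_deriv_weak_deriv: "has_weak_deriv u g \<Longrightarrow> has_weak_deriv u (weak_deriv u)"
  unfolding weak_deriv_def by (rule someI[of "has_weak_deriv u"])

definition L2 :: "(real \<Rightarrow> real) set" where
  "L2 = {u. u \<in> borel_measurable lebesgue \<and> integrable lebesgue (\<lambda>t. (u t)\<^sup>2)}"

definition L2_loc :: "(real \<Rightarrow> real) set" where
  "L2_loc = {u. u \<in> borel_measurable lebesgue \<and>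
                (\<forall>R. set_integrable lebesgue {-R..R} (\<lambda>t. (u t)\<^sup>2))}"

definition Linf_norm :: "(real \<Rightarrow> real) \<Rightarrow> ereal" where
  "Linf_norm u = esssup lebesgue (\<lambda>t. ereal \<bar>u t\<bar>)"

definition Linf :: "(real \<Rightarrow> real) set" where
  "Linf = {u. u \<in> borel_measurable lebesgue \<and> Linf_norm u < \<infinity>}"

definition H1 :: "(real \<Rightarrow> real) set" where
  "H1 = {u \<in> L2. \<exists>g\<in>L2. has_weak_deriv u g}"

definition H1_loc :: "(real \<Rightarrow> real) set" where
  "H1_loc = {u \<in> L2_loc. \<exists>g\<in>L2_loc. has_weak_deriv u g}"

(* Meaningful for \<delta> \<in> H1_loc. The integrand is nonnegative, so the integral is taken with
   values in [0,\<infinity>]; a divergent integral gives \<infinity>. *)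
definition phase_energy :: "real \<Rightarrow> (real \<Rightarrow> real) \<Rightarrow> (real \<Rightarrow> real) \<Rightarrow> ennreal" where
  "phase_energy m a \<delta> =
     2 * (\<integral>\<^sup>+ t. ennreal (
            (weak_deriv \<delta> t + m * sinh (2 * a t))\<^sup>2
          + (m * cosh (2 * a t) * cos (2 * \<delta> t) - weak_deriv a t * sin (2 * \<delta> t) - m)\<^sup>2
          + (m * cosh (2 * a t) * sin (2 * \<delta> t) + weak_deriv a t * cos (2 * \<delta> t))\<^sup>2) \<partial>lebesgue)"

definition phase_class :: "(real \<Rightarrow> real) set" where
  "phase_class = {\<delta> \<in> H1. AE t in lebesgue. \<bar>\<delta> t\<bar> \<le> pi / 2}"

(* Distributional form of
     \<delta>'' + 2 m a' cosh(2a) - 2 m^2 cosh(2a) sin(2\<delta>) - 2 m a' cos(2\<delta>) = 0: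
   the second derivative is tested as minus the integral of \<delta>' \<phi>'. The zero-order part is
   required to be locally integrable, so that no integral below takes a default value. *)
definition phase_weak_solution :: "real \<Rightarrow> (real \<Rightarrow> real) \<Rightarrow> (real \<Rightarrow> real) \<Rightarrow> bool" where
  "phase_weak_solution m a \<delta> \<longleftrightarrow>
     (let F = (\<lambda>t. 2 * m * weak_deriv a t * cosh (2 * a t)
                 - 2 * m\<^sup>2 * cosh (2 * a t) * sin (2 * \<delta> t)
                 - 2 * m * weak_deriv a t * cos (2 * \<delta> t))
      in \<delta> \<in> H1_loc \<and> locally_integrable F \<and>
         (\<forall>\<phi>\<in>test_functions.
            (LINT t|lebesgue. - (weak_deriv \<delta> t * deriv \<phi> t) + F t * \<phi> t) = 0))"

end

theory Submission
  imports Defs "HOL-Complex_Analysis.Great_Picard"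
begin

text \<open>
  Expanding the squares, the integrand of the functional is
  \<open>(\<delta>' + m sinh 2a)\<^sup>2\<close> plus a zero-order term which on \<open>\<bar>\<delta>\<bar> \<le> \<pi>/2\<close> dominates \<open>m\<^sup>2 \<delta>\<^sup>2 / 2 - a'\<^sup>2\<close>.
  Along a minimizing sequence the derivatives are therefore bounded in \<open>L\<^sup>2\<close>, the functions are
  uniformly bounded and uniformly Hoelder continuous, and a subsequence converges pointwise. The
  zero-order term passes to the limit by Fatou's lemma. For the derivative term, weak compactness is
  replaced by a parallelogram argument: elements of almost minimal norm in a decreasing sequence of
  convex sets, which control the primitives of the tail of the sequence, form a Cauchy sequence in
  \<open>L\<^sup>2\<close>, and its limit is the derivative of the pointwise limit.

  Perturbing a minimizer that stays away from \<open>\<plusminus>\<pi>/2\<close> by small multiples of a test function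
  gives the weak equation, where \<open>sinh 2a\<close> is integrated by parts with the chain rule. At
  \<open>\<delta> = 0\<close> the equation reads \<open>2m a' (cosh 2a - 1) = 0\<close>, so zero is not a
  minimizer unless this expression vanishes almost everywhere.
\<close>

section \<open>Smooth cut-off functions\<close>

text \<open>Fatou's lemma and the parallelogram argument give one upper bound for each of the two
  terms of the energy. These add up to the infimum because a further subsequence makes the terms
  converge separately, to \<alpha> and I - \<alpha>. Pointwise convergence on the whole line does
  not prevent mass from escaping to infinity, so the limit is shown to be square integrable
  afterwards, from the finiteness of its own zero-order term. The constraint matters here: that term
  is periodic in \<delta> with period pi, so it can bound \<delta> itself only on a range such as
  |\<delta>| \<le> pi/2. Absolutely continuous functions appear as functions whose increments are
  interval integrals (\<open>primitive\<close>). The lemma of du Bois-Reymond ties weak derivatives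
  to them, and it requires concrete smooth test functions; these are built from exp (-1/t). The
  first variation is found without differentiating under an integral: a bound for the energy
  increment by a quadratic polynomial in \<epsilon>, valid for both signs of \<epsilon>, already
  determines the linear coefficient.\<close>

lemma smooth_coinduct:
  assumes "f \<in> S"
    and step: "\<And>g. g \<in> S \<Longrightarrow> \<exists>g'\<in>S. \<forall>t. (g has_real_derivative g' t) (at t)"
  shows "(deriv ^^ n) f differentiable_on UNIV"
proof -
  \<comment> \<open>Membership in S is an invariant that survives each application of
    \<open>deriv\<close>, so the iterated derivatives never have to be computed.\<close>
  have deriv_mem: "deriv g \<in> S" if g: "g \<in> S" for g
  proof -
    obtain g' where g': "g' \<in> S" "\<forall>t. (g has_real_derivative g' t) (at t)"
      using step[OF g] by blast
    then have "deriv g = g'"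
      by (intro ext DERIV_imp_deriv) auto
    with g' show ?thesis by simp
  qed
  have "(deriv ^^ n) f \<in> S"
    by (induction n) (auto simp: assms(1) deriv_mem)
  from step[OF this] show ?thesis
    by (meson differentiable_at_withinI differentiable_on_def real_differentiable_def)
qed

text \<open>All derivatives of exp (-1/t), extended by 0 to t \<le> 0, are of this form: the
  polynomial in 1/t makes the family closed under differentiation.\<close>

definition flat :: "real poly \<Rightarrow> real \<Rightarrow> real" where
  "flat p t = (if t > 0 then poly p (inverse t) * exp (- inverse t) else 0)"

lemma poly_exp_tendsto_0: "((\<lambda>x. poly p x * exp (- x)) \<longlongrightarrow> (0::real)) at_top"
proof -
  have "((\<lambda>x. \<Sum>i\<le>degree p. coeff p i * (x ^ i / exp x)) \<longlongrightarrow> (\<Sum>i\<le>degree p. coeff p i * 0)) at_top"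
    by (intro tendsto_sum tendsto_mult tendsto_const tendsto_power_div_exp_0)
  then show ?thesis
    by (simp add: poly_altdef sum_distrib_right exp_minus divide_inverse mult.assoc)
qed

text \<open>With x = 1/t one has d/dt = - x^2 d/dx, and this operator turns p(x) exp (-x) into x^2
  (p - p') (x) exp (-x). Only t = 0 needs a limit.\<close>

lemma DERIV_flat:
  "(flat p has_real_derivative flat ([:0, 0, 1:] * (p - pderiv p)) t) (at t)"
proof -
  let ?q = "[:0, 0, 1:] * (p - pderiv p)"
  consider "t > 0" | "t < 0" | "t = 0" by linarith
  then show ?thesis
  proof cases
    case 1
    have "((\<lambda>t. poly p (inverse t) * exp (- inverse t)) has_real_derivative flat ?q t) (at t)"
      using 1 by (auto intro!: derivative_eq_intros simp: flat_def algebra_simps power2_eq_square)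
    moreover have "\<forall>\<^sub>F x in nhds t. flat p x = poly p (inverse x) * exp (- inverse x)"
      using eventually_nhds_in_open[of "{0<..}" t] 1
      by (auto elim!: eventually_mono simp: flat_def)
    ultimately show ?thesis
      by (subst DERIV_cong_ev[OF refl _ refl]) auto
  next
    case 2
    have "\<forall>\<^sub>F x in nhds t. flat p x = 0"
      using eventually_nhds_in_open[of "{..<0}" t] 2
      by (auto elim!: eventually_mono simp: flat_def)
    moreover have "flat ?q t = 0"
      using 2 by (simp add: flat_def)
    ultimately show ?thesis
      by (subst DERIV_cong_ev[OF refl _ refl, where g = "\<lambda>_. 0"]) auto
  next
    case 3
    \<comment> \<open>For h = 1/x the difference quotient is x p(x) exp (-x), with x tending to
      infinity.\<close>
    have "((\<lambda>h. (flat p (0 + h) - flat p 0) / h) \<longlongrightarrow> 0) (at_right 0)"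
    proof (subst filterlim_at_right_to_top, rule Lim_transform_eventually)
      show "((\<lambda>x. poly ([:0, 1:] * p) x * exp (- x)) \<longlongrightarrow> (0::real)) at_top"
        by (rule poly_exp_tendsto_0)
      show "\<forall>\<^sub>F x in at_top. poly ([:0, 1:] * p) x * exp (- x)
              = (flat p (0 + inverse x) - flat p 0) / inverse x"
        using eventually_gt_at_top[of 0]
        by eventually_elim (simp add: flat_def field_simps)
    qed
    moreover have "((\<lambda>h. (flat p (0 + h) - flat p 0) / h) \<longlongrightarrow> 0) (at_left 0)"
      by (rule tendsto_eventually) (auto simp: eventually_at_filter flat_def)
    ultimately show ?thesis
      using 3 by (simp add: DERIV_def filterlim_split_at flat_def)
  qed
qed

text \<open>The invariant set for \<open>smooth_coinduct\<close>: constants absorb the inner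
  derivative \<alpha> of the affine substitution, sums and products absorb the product rule.\<close>

inductive_set flat_alg :: "(real \<Rightarrow> real) set" where
  flat: "(\<lambda>t. flat p (\<alpha> * t + \<beta>)) \<in> flat_alg"
| const: "(\<lambda>_. \<alpha>) \<in> flat_alg"
| add: "f \<in> flat_alg \<Longrightarrow> g \<in> flat_alg \<Longrightarrow> (\<lambda>t. f t + g t) \<in> flat_alg"
| mult: "f \<in> flat_alg \<Longrightarrow> g \<in> flat_alg \<Longrightarrow> (\<lambda>t. f t * g t) \<in> flat_alg"

lemma flat_alg_deriv:
  assumes "f \<in> flat_alg"
  shows "\<exists>f'\<in>flat_alg. \<forall>t. (f has_real_derivative f' t) (at t)"
  using assms
proof induction
  case (flat p \<alpha> \<beta>)
  let ?q = "[:0, 0, 1:] * (p - pderiv p)"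
  have "((\<lambda>t. flat p (\<alpha> * t + \<beta>)) has_real_derivative flat ?q (\<alpha> * t + \<beta>) * \<alpha>) (at t)" for t
    by (rule DERIV_chain2[OF DERIV_flat]) (auto intro!: derivative_eq_intros)
  moreover have "(\<lambda>t. flat ?q (\<alpha> * t + \<beta>) * \<alpha>) \<in> flat_alg"
    by (intro flat_alg.intros)
  ultimately show ?case
    by (intro bexI[of _ "\<lambda>t. flat ?q (\<alpha> * t + \<beta>) * \<alpha>"]) auto
next
  case (const \<alpha>)
  then show ?case by (intro bexI[of _ "\<lambda>_. 0"]) (auto intro: flat_alg.intros)
next
  case (add f g)
  then obtain f' g' where "f' \<in> flat_alg" "g' \<in> flat_alg"
    "\<forall>t. (f has_real_derivative f' t) (at t)" "\<forall>t. (g has_real_derivative g' t) (at t)"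
    by blast
  then show ?case
    by (intro bexI[of _ "\<lambda>t. f' t + g' t"]) (auto intro: flat_alg.intros DERIV_add)
next
  case (mult f g)
  then obtain f' g' where "f' \<in> flat_alg" "g' \<in> flat_alg"
    "\<forall>t. (f has_real_derivative f' t) (at t)" "\<forall>t. (g has_real_derivative g' t) (at t)"
    by blast
  with mult show ?case
    by (intro bexI[of _ "\<lambda>t. f t * g' t + f' t * g t"])
       (auto intro!: flat_alg.intros derivative_eq_intros)
qed

lemma flat_alg_continuous: "f \<in> flat_alg \<Longrightarrow> continuous_on A f"
  using flat_alg_deriv[of f] by (auto intro: continuous_at_imp_continuous_on DERIV_isCont)

lemma smooth_flat_alg: "f \<in> flat_alg \<Longrightarrow> (deriv ^^ n) f differentiable_on UNIV"
  by (rule smooth_coinduct[of f flat_alg n, OF _ flat_alg_deriv])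

lemma compact_closure_supportI:
  fixes f :: "real \<Rightarrow> real"
  assumes "\<And>t. t \<notin> {x..y} \<Longrightarrow> f t = 0"
  shows "compact (closure {t. f t \<noteq> 0})"
proof -
  have "bounded {t. f t \<noteq> 0}"
    by (rule bounded_subset[of "{x..y}"]) (use assms in force)+
  then show ?thesis by (simp add: compact_closure)
qed

text \<open>An antiderivative of a member of \<open>flat_alg\<close> need not be a member itself, so
  F is added to the invariant set; its derivative falls back into \<open>flat_alg\<close>.\<close>

lemma test_function_primitiveI:
  assumes "f \<in> flat_alg" "\<And>t. (F has_real_derivative f t) (at t)" "\<And>t. t \<notin> {x..y} \<Longrightarrow> F t = 0"
  shows "F \<in> test_functions"
proof -
  have "(deriv ^^ n) F differentiable_on UNIV" for n
  proof (rule smooth_coinduct[of F "insert F flat_alg" n])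
    fix g assume "g \<in> insert F flat_alg"
    then show "\<exists>g'\<in>insert F flat_alg. \<forall>t. (g has_real_derivative g' t) (at t)"
    proof
      assume "g = F"
      with assms(1,2) show ?thesis by blast
    next
      assume "g \<in> flat_alg"
      then show ?thesis using flat_alg_deriv by blast
    qed
  qed simp
  with compact_closure_supportI[of x y F] assms(3) show ?thesis
    by (simp add: test_functions_def)
qed

text \<open>Since \<open>exp (- 1 / (n s)) \<longrightarrow> 1\<close> for every \<open>s > 0\<close>, these cut-offs tend to the indicator function of the open interval.\<close>

definition plateau :: "nat \<Rightarrow> real \<Rightarrow> real \<Rightarrow> real \<Rightarrow> real" where
  "plateau n x y t = flat 1 (real (Suc n) * (t - x)) * flat 1 (real (Suc n) * (y - t))"

lemma plateau_flat_alg: "plateau n x y \<in> flat_alg"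
proof -
  have "plateau n x y = (\<lambda>t. flat 1 (real (Suc n) * t + - (real (Suc n) * x))
          * flat 1 (- real (Suc n) * t + real (Suc n) * y))"
    by (rule ext) (simp add: plateau_def right_diff_distrib del: of_nat_Suc)
  then show ?thesis
    using flat_alg.mult[OF flat_alg.flat flat_alg.flat,
      of 1 "real (Suc n)" "- (real (Suc n) * x)" 1 "- real (Suc n)" "real (Suc n) * y"]
    by presburger
qed

lemma plateau_outside: "t \<notin> {x<..<y} \<Longrightarrow> plateau n x y t = 0"
  by (cases "x < t") (auto simp: plateau_def flat_def zero_less_mult_iff)

lemma plateau_test_function: "plateau n x y \<in> test_functions"
proof -
  have "compact (closure {t. plateau n x y t \<noteq> 0})"
    by (rule compact_closure_supportI[of x y]) (auto intro!: plateau_outside)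
  with smooth_flat_alg[OF plateau_flat_alg] show ?thesis
    by (simp add: test_functions_def)
qed

lemma flat_1_bounds: "0 \<le> flat 1 t" "flat 1 t \<le> 1"
  by (auto simp: flat_def)

lemma plateau_bounds: "0 \<le> plateau n x y t" "plateau n x y t \<le> 1"
  using flat_1_bounds by (auto simp: plateau_def mult_le_one)

lemma flat_1_scaled_tendsto:
  assumes "t > 0" shows "(\<lambda>n. flat 1 (real (Suc n) * t)) \<longlonglongrightarrow> 1"
proof -
  have "(\<lambda>n. exp (- (inverse (real (Suc n)) * inverse t))) \<longlonglongrightarrow> exp (- (0 * inverse t))"
    by (intro tendsto_intros LIMSEQ_inverse_real_of_nat)
  then show ?thesis
    using assms by (simp add: flat_def zero_less_mult_iff inverse_mult_distrib del: of_nat_Suc)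
qed

lemma plateau_tendsto: "(\<lambda>n. plateau n x y t) \<longlonglongrightarrow> indicat_real {x<..<y} t"
proof (cases "t \<in> {x<..<y}")
  case True
  then have "(\<lambda>n. plateau n x y t) \<longlonglongrightarrow> 1 * 1"
    unfolding plateau_def by (intro tendsto_mult flat_1_scaled_tendsto) auto
  with True show ?thesis by simp
qed (simp add: plateau_outside)

lemma plateau_pos: "t \<in> {x<..<y} \<Longrightarrow> plateau n x y t > 0"
  by (auto simp: plateau_def flat_def)

section \<open>Indefinite integrals of locally integrable functions\<close>

lemma locally_integrable_Icc:
  assumes "locally_integrable g"
  shows "set_integrable lebesgue {x..y} g"
proof -
  have "set_integrable lebesgue {-max \<bar>x\<bar> \<bar>y\<bar>..max \<bar>x\<bar> \<bar>y\<bar>} g"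
    using assms by (simp add: locally_integrable_def)
  then show ?thesis
    by (rule set_integrable_subset) auto
qed

lemma locally_integrableI: "(\<And>x y. set_integrable lebesgue {x..y} g) \<Longrightarrow> locally_integrable g"
  by (simp add: locally_integrable_def)

lemma continuous_locally_integrable:
  assumes "continuous_on UNIV f" shows "locally_integrable f"
  by (rule locally_integrableI, rule absolutely_integrable_continuous_real)
     (use assms continuous_on_subset in blast)

text \<open>At each point the truncations to [-n, n], whose measurability is part of
  \<open>set_integrable\<close>, agree with g from some n on.\<close>

lemma locally_integrable_measurable:
  assumes "locally_integrable g"
  shows "g \<in> borel_measurable lebesgue"
proof (rule borel_measurable_LIMSEQ_real)
  show "(\<lambda>t. indicat_real {- real n..real n} t * g t) \<in> borel_measurable lebesgue" for n
    using locally_integrable_Icc[OF assms, of "- real n" "real n"]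
    by (auto simp: set_integrable_def dest: borel_measurable_integrable)
  show "(\<lambda>n. indicat_real {- real n..real n} t * g t) \<longlonglongrightarrow> g t" for t
  proof (rule tendsto_eventually)
    have "\<forall>\<^sub>F n in sequentially. \<bar>t\<bar> \<le> real n"
      by (rule eventually_sequentiallyI[of "nat \<lceil>\<bar>t\<bar>\<rceil>"]) linarith
    then show "\<forall>\<^sub>F n in sequentially. indicat_real {- real n..real n} t * g t = g t"
      by eventually_elim (auto simp: indicator_def)
  qed
qed

lemma lebesgue_measurable_ident [measurable]: "(\<lambda>x. x) \<in> borel_measurable (lebesgue :: real measure)"
  by (rule measurable_completion) simp

lemma locally_integrable_bound:
  assumes f: "locally_integrable f" and g: "g \<in> borel_measurable lebesgue"
    and le: "\<And>R. AE t in lebesgue. t \<in> {-R..R} \<longrightarrow> \<bar>g t\<bar> \<le> f t"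
  shows "locally_integrable g"
  unfolding locally_integrable_def
proof
  fix R
  show "set_integrable lebesgue {-R..R} g"
    unfolding set_integrable_def
  proof (rule Bochner_Integration.integrable_bound)
    show "integrable lebesgue (\<lambda>t. indicat_real {-R..R} t *\<^sub>R f t)"
      using f by (simp add: locally_integrable_def set_integrable_def)
    show "AE t in lebesgue. norm (indicat_real {-R..R} t *\<^sub>R g t) \<le> norm (indicat_real {-R..R} t *\<^sub>R f t)"
      using le[of R] by eventually_elim (auto simp: indicator_def)
    have [measurable]: "g \<in> borel_measurable lebesgue" by (rule g)
    show "(\<lambda>t. indicat_real {-R..R} t *\<^sub>R g t) \<in> borel_measurable lebesgue" by measurable
  qed
qed

lemma locally_integrable_add:
  "locally_integrable f \<Longrightarrow> locally_integrable g \<Longrightarrow> locally_integrable (\<lambda>t. f t + g t)"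
  by (auto simp: locally_integrable_def)

lemma locally_integrable_diff:
  "locally_integrable f \<Longrightarrow> locally_integrable g \<Longrightarrow> locally_integrable (\<lambda>t. f t - g t)"
  by (auto simp: locally_integrable_def)

lemma locally_integrable_mult:
  "locally_integrable f \<Longrightarrow> locally_integrable (\<lambda>t. c * f t)"
  by (auto simp: locally_integrable_def)

lemma locally_integrable_abs:
  "locally_integrable f \<Longrightarrow> locally_integrable (\<lambda>t. \<bar>f t\<bar>)"
  by (auto simp: locally_integrable_def intro: set_integrable_abs)

lemma locally_integrable_mult_bounded:
  assumes f: "locally_integrable f" and g: "g \<in> borel_measurable lebesgue"
    and B: "\<And>R. \<exists>B. AE t in lebesgue. t \<in> {-R..R} \<longrightarrow> \<bar>g t\<bar> \<le> B"
  shows "locally_integrable (\<lambda>t. f t * g t)"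
  unfolding locally_integrable_def
proof
  fix R
  obtain B where B: "AE t in lebesgue. t \<in> {-R..R} \<longrightarrow> \<bar>g t\<bar> \<le> B"
    using B by blast
  have [measurable]: "f \<in> borel_measurable lebesgue" "g \<in> borel_measurable lebesgue"
    using f g by (auto simp: locally_integrable_measurable)
  show "set_integrable lebesgue {-R..R} (\<lambda>t. f t * g t)"
    unfolding set_integrable_def
  proof (rule Bochner_Integration.integrable_bound)
    have "set_integrable lebesgue {-R..R} (\<lambda>t. B * \<bar>f t\<bar>)"
      using f by (intro set_integrable_mult_right set_integrable_abs) (simp add: locally_integrable_def)
    then show "integrable lebesgue (\<lambda>t. indicat_real {-R..R} t *\<^sub>R (B * \<bar>f t\<bar>))"
      by (simp add: set_integrable_def)
    show "AE t in lebesgue. norm (indicat_real {-R..R} t *\<^sub>R (f t * g t))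
        \<le> norm (indicat_real {-R..R} t *\<^sub>R (B * \<bar>f t\<bar>))"
      using B
    proof eventually_elim
      case (elim t)
      then show ?case
        using mult_left_mono[of "\<bar>g t\<bar>" B "\<bar>f t\<bar>"] by (auto simp: indicator_def abs_mult mult.commute)
    qed
  qed measurable
qed

lemma continuous_bounded_Icc:
  fixes g :: "real \<Rightarrow> real"
  assumes "continuous_on UNIV g" shows "\<exists>B. \<forall>t\<in>{x..y}. \<bar>g t\<bar> \<le> B"
proof -
  have "compact (g ` {x..y})"
    by (rule compact_continuous_image) (use assms continuous_on_subset in auto)
  then have "bounded (g ` {x..y})" by (rule compact_imp_bounded)
  then show ?thesis by (auto simp: bounded_iff)
qed

lemma continuous_lebesgue_measurable:
  "continuous_on UNIV (g :: real \<Rightarrow> real) \<Longrightarrow> g \<in> borel_measurable lebesgue"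
  by (simp add: borel_measurable_continuous_onI measurable_completion)

lemma locally_integrable_mult_continuous:
  assumes "locally_integrable f" "continuous_on UNIV g"
  shows "locally_integrable (\<lambda>t. f t * g t)"
proof (rule locally_integrable_mult_bounded[OF assms(1) continuous_lebesgue_measurable[OF assms(2)]])
  show "\<exists>B. AE t in lebesgue. t \<in> {- R..R} \<longrightarrow> \<bar>g t\<bar> \<le> B" for R
    using continuous_bounded_Icc[OF assms(2), of "-R" R] by blast
qed

lemma L2_locally_integrable:
  assumes "u \<in> L2" shows "locally_integrable u"
proof (rule locally_integrable_bound[of "\<lambda>t. 1 + (u t)\<^sup>2"])
  show "locally_integrable (\<lambda>t. 1 + (u t)\<^sup>2)"
  proof (rule locally_integrable_add)
    show "locally_integrable (\<lambda>t. (u t)\<^sup>2)"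
      using assms integrable_mult_indicator[of "{-R..R}" lebesgue "\<lambda>t. (u t)\<^sup>2" for R]
      by (auto simp: L2_def locally_integrable_def set_integrable_def)
  qed (auto intro: continuous_locally_integrable)
  have "\<bar>x\<bar> \<le> 1 + x\<^sup>2" for x :: real
    using sum_squares_bound[of "\<bar>x\<bar>" 1] zero_le_power2[of x] by simp
  then show "AE t in lebesgue. t \<in> {- R..R} \<longrightarrow> \<bar>u t\<bar> \<le> 1 + (u t)\<^sup>2" for R
    by simp
qed (use assms in \<open>simp add: L2_def\<close>)

lemma set_integral_split_Icc:
  assumes "locally_integrable g" "x \<le> y" "y \<le> z"
  shows "(LINT t:{x..z}|lebesgue. g t) = (LINT t:{x..y}|lebesgue. g t) + (LINT t:{y..z}|lebesgue. g t)"
proof -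
  note I = set_lebesgue_integral_eq_integral[OF locally_integrable_Icc[OF assms(1)]]
  show ?thesis
    unfolding I(2) using Henstock_Kurzweil_Integration.integral_combine[OF assms(2,3) I(1)] by simp
qed

text \<open>Local absolute continuity of G with derivative g, in integrated form. It avoids
  differentiability almost everywhere and is stable under the pointwise limits taken later.\<close>

definition primitive :: "(real \<Rightarrow> real) \<Rightarrow> (real \<Rightarrow> real) \<Rightarrow> bool" where
  "primitive G g \<longleftrightarrow> locally_integrable g \<and>
     (\<forall>x y. x \<le> y \<longrightarrow> G y - G x = (LINT t:{x..y}|lebesgue. g t))"

lemma set_integral_singleton [simp]: "(LINT t:{x}|lebesgue. g t) = (0::real)" for x :: real
proof -
  have "AE t in lebesgue. indicat_real {x} t *\<^sub>R g t = 0"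
    using AE_completion[OF AE_lborel_singleton[of x]] by eventually_elim (auto simp: indicator_def)
  then show ?thesis
    unfolding set_lebesgue_integral_def by (rule integral_eq_zero_AE)
qed

lemma primitive_exists:
  assumes "locally_integrable g"
  shows "\<exists>G. primitive G g \<and> G 0 = c"
proof -
  let ?G = "\<lambda>x. c + (if x \<ge> 0 then LINT t:{0..x}|lebesgue. g t else - (LINT t:{x..0}|lebesgue. g t))"
  have "?G y - ?G x = (LINT t:{x..y}|lebesgue. g t)" if "x \<le> y" for x y
  proof -
    consider "0 \<le> x" | "x < 0" "0 \<le> y" | "y < 0" by linarith
    then show ?thesis
    proof cases
      case 1
      with that set_integral_split_Icc[OF assms, of 0 x y] show ?thesis by simp
    next
      case 2
      with that set_integral_split_Icc[OF assms, of x 0 y] show ?thesis by simp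
    next
      case 3
      with that set_integral_split_Icc[OF assms, of x y 0] show ?thesis by simp
    qed
  qed
  then have "primitive ?G g" using assms by (simp add: primitive_def)
  moreover have "?G 0 = c" by simp
  ultimately show ?thesis by blast
qed

section \<open>Calculus rules for primitives\<close>

lemma primitive_continuous:
  assumes "primitive G g" shows "continuous_on UNIV G"
proof -
  have li: "locally_integrable g" using assms by (simp add: primitive_def)
  note I = set_lebesgue_integral_eq_integral[OF locally_integrable_Icc[OF li]]
  have "isCont G x" for x
  proof -
    have "continuous_on {x-1..x+1} (\<lambda>t. G (x-1) + integral {x-1..t} g)"
      by (rule continuous_on_add[OF continuous_on_const indefinite_integral_continuous_1[OF I(1)]])
    moreover have "G (x-1) + integral {x-1..t} g = G t" if "t \<in> {x-1..x+1}" for t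
    proof -
      have "G t - G (x-1) = (LINT s:{x-1..t}|lebesgue. g s)"
        using assms that by (simp add: primitive_def)
      then show ?thesis by (simp add: I(2))
    qed
    ultimately have "continuous_on {x-1..x+1} G"
      by (rule continuous_on_eq)
    then show ?thesis
      by (rule continuous_on_interior) (simp add: interior_atLeastAtMost_real)
  qed
  then show ?thesis by (simp add: continuous_at_imp_continuous_on)
qed

lemma primitive_locally_integrable: "primitive G g \<Longrightarrow> locally_integrable g"
  by (simp add: primitive_def)

lemma primitive_increment:
  "primitive G g \<Longrightarrow> x \<le> y \<Longrightarrow> G y - G x = (LINT t:{x..y}|lebesgue. g t)"
  by (simp add: primitive_def)

lemma primitive_add:
  "primitive F f \<Longrightarrow> primitive G g \<Longrightarrow> primitive (\<lambda>t. F t + G t) (\<lambda>t. f t + g t)"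
  unfolding primitive_def
  by (simp add: locally_integrable_add set_integral_add(2)[OF locally_integrable_Icc locally_integrable_Icc]
      add_diff_add)

lemma primitive_mult:
  "primitive F f \<Longrightarrow> primitive (\<lambda>t. c * F t) (\<lambda>t. c * f t)"
  unfolding primitive_def
  by (auto simp: locally_integrable_mult right_diff_distrib[symmetric])

text \<open>V plays the role of a variation. On an equidistant subdivision with mesh below \<eta>
  both sides telescope, which leaves the bound \<epsilon> (V \<beta> - V \<alpha>) with \<epsilon>
  arbitrary.\<close>

lemma increments_dominated_imp_eq:
  fixes \<Phi> V :: "real \<Rightarrow> real"
  assumes "\<alpha> \<le> \<beta>"
    and dom: "\<And>\<epsilon>. \<epsilon> > 0 \<Longrightarrow> \<exists>\<eta>>0. \<forall>x y. \<alpha> \<le> x \<and> x \<le> y \<and> y \<le> \<beta> \<and> y - x < \<eta> \<longrightarrow>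
                \<bar>\<Phi> y - \<Phi> x\<bar> \<le> \<epsilon> * (V y - V x)"
  shows "\<Phi> \<beta> = \<Phi> \<alpha>"
proof -
  have le: "\<bar>\<Phi> \<beta> - \<Phi> \<alpha>\<bar> \<le> \<epsilon> * (V \<beta> - V \<alpha>)" if "\<epsilon> > 0" for \<epsilon>
  proof -
    obtain \<eta> where "\<eta> > 0" and \<eta>: "\<And>x y. \<alpha> \<le> x \<Longrightarrow> x \<le> y \<Longrightarrow> y \<le> \<beta> \<Longrightarrow> y - x < \<eta> \<Longrightarrow>
                \<bar>\<Phi> y - \<Phi> x\<bar> \<le> \<epsilon> * (V y - V x)"
      using dom[OF \<open>\<epsilon> > 0\<close>] by blast
    obtain n :: nat where n: "(\<beta> - \<alpha>) / \<eta> < real n"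
      using reals_Archimedean2 by blast
    have "n > 0"
      using n \<open>\<eta> > 0\<close> \<open>\<alpha> \<le> \<beta>\<close> by (auto intro!: Nat.gr0I simp: field_simps)
    define h where "h = (\<beta> - \<alpha>) / real n"
    have h: "0 \<le> h" "h < \<eta>" "real n * h = \<beta> - \<alpha>"
      using n \<open>n > 0\<close> \<open>\<eta> > 0\<close> \<open>\<alpha> \<le> \<beta>\<close> by (auto simp: h_def field_simps)
    define p where "p i = \<alpha> + real i * h" for i
    have p: "p 0 = \<alpha>" "p n = \<beta>"
      using h by (auto simp: p_def)
    have step: "\<bar>\<Phi> (p (Suc i)) - \<Phi> (p i)\<bar> \<le> \<epsilon> * (V (p (Suc i)) - V (p i))" if "i < n" for i
    proof (rule \<eta>)
      have "real (Suc i) * h \<le> real n * h"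
        using that h by (intro mult_right_mono) auto
      then show "p (Suc i) \<le> \<beta>" using h by (simp add: p_def)
    qed (use h in \<open>auto simp: p_def algebra_simps\<close>)
    have "\<bar>\<Phi> \<beta> - \<Phi> \<alpha>\<bar> = \<bar>\<Sum>i<n. \<Phi> (p (Suc i)) - \<Phi> (p i)\<bar>"
      by (simp add: sum_lessThan_telescope[of "\<lambda>i. \<Phi> (p i)"] p)
    also have "\<dots> \<le> (\<Sum>i<n. \<epsilon> * (V (p (Suc i)) - V (p i)))"
      by (rule order_trans[OF sum_abs sum_mono]) (use step in auto)
    also have "\<dots> = \<epsilon> * (V \<beta> - V \<alpha>)"
      by (simp add: sum_distrib_left[symmetric] sum_lessThan_telescope[of "\<lambda>i. V (p i)"] p)
    finally show ?thesis .
  qed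
  show ?thesis
  proof (rule ccontr)
    assume "\<Phi> \<beta> \<noteq> \<Phi> \<alpha>"
    then have pos: "\<bar>\<Phi> \<beta> - \<Phi> \<alpha>\<bar> > 0" by simp
    \<comment> \<open>A positive upper bound for V \<beta> - V \<alpha>; with it \<epsilon> can be
      chosen so that the bound is at most half of the quantity it bounds.\<close>
    define v where "v = \<bar>V \<beta> - V \<alpha>\<bar> + 1"
    have "v > 0" by (simp add: v_def)
    have "\<bar>\<Phi> \<beta> - \<Phi> \<alpha>\<bar> \<le> (\<bar>\<Phi> \<beta> - \<Phi> \<alpha>\<bar> / (2 * v)) * (V \<beta> - V \<alpha>)"
      using pos \<open>v > 0\<close> by (intro le) simp
    also have "\<dots> \<le> (\<bar>\<Phi> \<beta> - \<Phi> \<alpha>\<bar> / (2 * v)) * v"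
      using pos \<open>v > 0\<close> by (intro mult_left_mono) (auto simp: v_def)
    also have "\<dots> = \<bar>\<Phi> \<beta> - \<Phi> \<alpha>\<bar> / 2" using \<open>v > 0\<close> by simp
    finally show False using pos by simp
  qed
qed

lemma continuous_uniform_Icc:
  fixes F :: "real \<Rightarrow> real"
  assumes "continuous_on UNIV F" "\<epsilon> > 0"
  obtains \<eta> where "\<eta> > 0"
    "\<And>s t. s \<in> {\<alpha>..\<beta>} \<Longrightarrow> t \<in> {\<alpha>..\<beta>} \<Longrightarrow> \<bar>s - t\<bar> < \<eta> \<Longrightarrow> \<bar>F s - F t\<bar> < \<epsilon>"
proof -
  have "uniformly_continuous_on {\<alpha>..\<beta>} F"
    by (rule compact_uniformly_continuous) (use assms continuous_on_subset in auto)
  with \<open>\<epsilon> > 0\<close> obtain \<eta> where "\<eta> > 0"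
    "\<And>s t. s \<in> {\<alpha>..\<beta>} \<Longrightarrow> t \<in> {\<alpha>..\<beta>} \<Longrightarrow> dist t s < \<eta> \<Longrightarrow> dist (F t) (F s) < \<epsilon>"
    unfolding uniformly_continuous_on_def by blast
  with that[of \<eta>] show ?thesis by (simp add: dist_real_def abs_minus_commute)
qed

text \<open>
  Both the product rule and the chain rule hold up to an error \<open>\<epsilon> \<integral> v\<close> on short intervals, by
  uniform continuity; this is all that is needed, as the errors add up to \<open>\<epsilon> \<integral> v\<close> on the whole interval.
\<close>

lemma primitiveI_increments:
  assumes h: "locally_integrable h" and v: "locally_integrable v"
    and dom: "\<And>\<alpha> \<beta> \<epsilon>. \<alpha> \<le> \<beta> \<Longrightarrow> \<epsilon> > 0 \<Longrightarrow> \<exists>\<eta>>0. \<forall>x y. \<alpha> \<le> x \<and> x \<le> y \<and> y \<le> \<beta> \<and> y - x < \<eta> \<longrightarrow>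
      \<bar>\<Phi> y - \<Phi> x - (LINT t:{x..y}|lebesgue. h t)\<bar> \<le> \<epsilon> * (LINT t:{x..y}|lebesgue. v t)"
  shows "primitive \<Phi> h"
  unfolding primitive_def
proof (intro conjI allI impI h)
  fix \<alpha> \<beta> :: real assume "\<alpha> \<le> \<beta>"
  obtain H where H: "primitive H h" using primitive_exists[OF h] by blast
  obtain V where V: "primitive V v" using primitive_exists[OF v] by blast
  have "\<Phi> \<beta> - H \<beta> = \<Phi> \<alpha> - H \<alpha>"
  proof (rule increments_dominated_imp_eq[OF \<open>\<alpha> \<le> \<beta>\<close>, of _ V])
    fix \<epsilon> :: real assume "\<epsilon> > 0"
    have "\<Phi> y - H y - (\<Phi> x - H x) = \<Phi> y - \<Phi> x - (LINT t:{x..y}|lebesgue. h t)"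
      and "V y - V x = (LINT t:{x..y}|lebesgue. v t)" if "x \<le> y" for x y
      using primitive_increment[OF H that] primitive_increment[OF V that] by simp_all
    with dom[OF \<open>\<alpha> \<le> \<beta>\<close> \<open>\<epsilon> > 0\<close>]
    show "\<exists>\<eta>>0. \<forall>x y. \<alpha> \<le> x \<and> x \<le> y \<and> y \<le> \<beta> \<and> y - x < \<eta> \<longrightarrow>
       \<bar>\<Phi> y - H y - (\<Phi> x - H x)\<bar> \<le> \<epsilon> * (V y - V x)"
      by (metis (no_types, lifting))
  qed
  with primitive_increment[OF H \<open>\<alpha> \<le> \<beta>\<close>]
  show "\<Phi> \<beta> - \<Phi> \<alpha> = (LINT t:{\<alpha>..\<beta>}|lebesgue. h t)" by simp
qed

lemma set_integral_abs_le:
  assumes "locally_integrable f" "locally_integrable g" "\<And>t. t \<in> {x..y} \<Longrightarrow> \<bar>f t\<bar> \<le> g t"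
  shows "\<bar>LINT t:{x..y}|lebesgue. f t\<bar> \<le> (LINT t:{x..y}|lebesgue. g t)"
proof -
  have "\<bar>LINT t:{x..y}|lebesgue. f t\<bar> \<le> (LINT t:{x..y}|lebesgue. norm (f t))"
    using set_integral_norm_bound[OF locally_integrable_Icc[OF assms(1)]] by simp
  also have "\<dots> \<le> (LINT t:{x..y}|lebesgue. g t)"
    using assms by (intro set_integral_mono locally_integrable_Icc) (auto intro: locally_integrable_abs)
  finally show ?thesis .
qed

lemma primitive_times:
  assumes F: "primitive F f" and G: "primitive G g"
  shows "primitive (\<lambda>t. F t * G t) (\<lambda>t. F t * g t + f t * G t)"
proof (rule primitiveI_increments[of _ "\<lambda>t. \<bar>f t\<bar> + \<bar>g t\<bar>"])
  note li = primitive_locally_integrable[OF F] primitive_locally_integrable[OF G]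
  note cont = primitive_continuous[OF F] primitive_continuous[OF G]
  show li1: "locally_integrable (\<lambda>t. F t * g t + f t * G t)"
    using locally_integrable_mult_continuous[OF li(2) cont(1)]
      locally_integrable_mult_continuous[OF li(1) cont(2)]
    by (auto simp: mult.commute intro: locally_integrable_add)
  show li2: "locally_integrable (\<lambda>t. \<bar>f t\<bar> + \<bar>g t\<bar>)"
    using li by (intro locally_integrable_add locally_integrable_abs)
  fix \<alpha> \<beta> \<epsilon> :: real assume "\<alpha> \<le> \<beta>" "\<epsilon> > 0"
  obtain \<eta>1 where \<eta>1: "\<eta>1 > 0"
    "\<And>s t. s \<in> {\<alpha>..\<beta>} \<Longrightarrow> t \<in> {\<alpha>..\<beta>} \<Longrightarrow> \<bar>s - t\<bar> < \<eta>1 \<Longrightarrow> \<bar>F s - F t\<bar> < \<epsilon>"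
    using continuous_uniform_Icc[OF cont(1) \<open>\<epsilon> > 0\<close>] by metis
  obtain \<eta>2 where \<eta>2: "\<eta>2 > 0"
    "\<And>s t. s \<in> {\<alpha>..\<beta>} \<Longrightarrow> t \<in> {\<alpha>..\<beta>} \<Longrightarrow> \<bar>s - t\<bar> < \<eta>2 \<Longrightarrow> \<bar>G s - G t\<bar> < \<epsilon>"
    using continuous_uniform_Icc[OF cont(2) \<open>\<epsilon> > 0\<close>] by metis
  show "\<exists>\<eta>>0. \<forall>x y. \<alpha> \<le> x \<and> x \<le> y \<and> y \<le> \<beta> \<and> y - x < \<eta> \<longrightarrow>
      \<bar>F y * G y - F x * G x - (LINT t:{x..y}|lebesgue. F t * g t + f t * G t)\<bar>
        \<le> \<epsilon> * (LINT t:{x..y}|lebesgue. \<bar>f t\<bar> + \<bar>g t\<bar>)"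
  proof (intro exI[of _ "min \<eta>1 \<eta>2"] conjI allI impI)
    fix x y assume xy: "\<alpha> \<le> x \<and> x \<le> y \<and> y \<le> \<beta> \<and> y - x < min \<eta>1 \<eta>2"
    \<comment> \<open>Freezing F at y and G at x turns the increment into one integral with constant
      coefficients, to be compared under the integral sign.\<close>
    have "F y * G y - F x * G x = F y * (G y - G x) + G x * (F y - F x)"
      by (simp add: algebra_simps)
    also have "\<dots> = (LINT t:{x..y}|lebesgue. F y * g t + G x * f t)"
      using xy primitive_increment[OF F, of x y] primitive_increment[OF G, of x y] li
      by (simp add: locally_integrable_Icc set_integral_add(2))
    finally have "F y * G y - F x * G x - (LINT t:{x..y}|lebesgue. F t * g t + f t * G t)
        = (LINT t:{x..y}|lebesgue. (F y * g t + G x * f t) - (F t * g t + f t * G t))"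
      using li li1
      by (simp add: locally_integrable_Icc set_integral_diff(2) locally_integrable_add locally_integrable_mult)
    also have "\<bar>\<dots>\<bar> \<le> (LINT t:{x..y}|lebesgue. \<epsilon> * (\<bar>f t\<bar> + \<bar>g t\<bar>))"
    proof (rule set_integral_abs_le)
      fix t assume t: "t \<in> {x..y}"
      have 1: "\<bar>F y - F t\<bar> \<le> \<epsilon>" "\<bar>G x - G t\<bar> \<le> \<epsilon>"
        using \<eta>1(2)[of y t] \<eta>2(2)[of x t] t xy by force+
      have "\<bar>F y * g t + G x * f t - (F t * g t + f t * G t)\<bar>
          = \<bar>(F y - F t) * g t + (G x - G t) * f t\<bar>"
        by (simp add: algebra_simps)
      also have "\<dots> \<le> \<bar>F y - F t\<bar> * \<bar>g t\<bar> + \<bar>G x - G t\<bar> * \<bar>f t\<bar>"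
        by (metis abs_mult abs_triangle_ineq)
      also have "\<dots> \<le> \<epsilon> * \<bar>g t\<bar> + \<epsilon> * \<bar>f t\<bar>"
        using 1 by (intro add_mono mult_right_mono) auto
      finally show "\<bar>F y * g t + G x * f t - (F t * g t + f t * G t)\<bar> \<le> \<epsilon> * (\<bar>f t\<bar> + \<bar>g t\<bar>)"
        by (simp add: algebra_simps)
    qed (use li li1 li2 in \<open>auto intro!: locally_integrable_add locally_integrable_mult locally_integrable_diff\<close>)
    finally show "\<bar>F y * G y - F x * G x - (LINT t:{x..y}|lebesgue. F t * g t + f t * G t)\<bar>
        \<le> \<epsilon> * (LINT t:{x..y}|lebesgue. \<bar>f t\<bar> + \<bar>g t\<bar>)"
      by simp
  qed (use \<eta>1 \<eta>2 in auto)
qed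

text \<open>A is only continuous. The mean value theorem is applied to f between the values A x and
  A y, and the intermediate value theorem for A pulls the point found there back to [x, y].\<close>

lemma mean_value_compose:
  fixes A f :: "real \<Rightarrow> real"
  assumes A: "continuous_on UNIV A" and f: "\<And>t. (f has_real_derivative f' t) (at t)" and "x \<le> y"
  shows "\<exists>s\<in>{x..y}. f (A y) - f (A x) = f' (A s) * (A y - A x)"
proof -
  have contA: "continuous_on {x..y} A" using A continuous_on_subset by blast
  consider "A x = A y" | "A x < A y" | "A x > A y" by linarith
  then show ?thesis
  proof cases
    case 1 with \<open>x \<le> y\<close> show ?thesis by auto
  next
    case 2
    obtain z where z: "A x < z" "z < A y" "f (A y) - f (A x) = (A y - A x) * f' z"
      using MVT2[OF 2 f] by blast
    obtain s where "x \<le> s" "s \<le> y" "A s = z"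
      using IVT'[of A x z y] z \<open>x \<le> y\<close> contA by auto
    with z show ?thesis by (intro bexI[of _ s]) auto
  next
    case 3
    obtain z where z: "A y < z" "z < A x" "f (A x) - f (A y) = (A x - A y) * f' z"
      using MVT2[OF 3 f] by blast
    obtain s where "x \<le> s" "s \<le> y" "A s = z"
      using IVT2'[of A y z x] z \<open>x \<le> y\<close> contA by auto
    with z show ?thesis by (intro bexI[of _ s]) (auto simp: algebra_simps)
  qed
qed

lemma primitive_compose:
  assumes A: "primitive A b" and f: "\<And>t. (f has_real_derivative f' t) (at t)"
    and f': "continuous_on UNIV f'"
  shows "primitive (\<lambda>t. f (A t)) (\<lambda>t. f' (A t) * b t)"
proof (rule primitiveI_increments[of _ "\<lambda>t. \<bar>b t\<bar>"])
  note li = primitive_locally_integrable[OF A]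
  note cont = primitive_continuous[OF A]
  have cont': "continuous_on UNIV (\<lambda>t. f' (A t))"
    by (rule continuous_on_compose2[OF f' cont]) auto
  show li1: "locally_integrable (\<lambda>t. f' (A t) * b t)"
    using locally_integrable_mult_continuous[OF li cont'] by (simp add: mult.commute)
  show li2: "locally_integrable (\<lambda>t. \<bar>b t\<bar>)"
    using li by (rule locally_integrable_abs)
  fix \<alpha> \<beta> \<epsilon> :: real assume "\<alpha> \<le> \<beta>" "\<epsilon> > 0"
  obtain \<eta> where \<eta>: "\<eta> > 0"
    "\<And>s t. s \<in> {\<alpha>..\<beta>} \<Longrightarrow> t \<in> {\<alpha>..\<beta>} \<Longrightarrow> \<bar>s - t\<bar> < \<eta> \<Longrightarrow> \<bar>f' (A s) - f' (A t)\<bar> < \<epsilon>"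
    using continuous_uniform_Icc[OF cont' \<open>\<epsilon> > 0\<close>] by metis
  show "\<exists>\<eta>>0. \<forall>x y. \<alpha> \<le> x \<and> x \<le> y \<and> y \<le> \<beta> \<and> y - x < \<eta> \<longrightarrow>
      \<bar>f (A y) - f (A x) - (LINT t:{x..y}|lebesgue. f' (A t) * b t)\<bar>
        \<le> \<epsilon> * (LINT t:{x..y}|lebesgue. \<bar>b t\<bar>)"
  proof (intro exI[of _ \<eta>] conjI allI impI \<eta>(1))
    fix x y assume xy: "\<alpha> \<le> x \<and> x \<le> y \<and> y \<le> \<beta> \<and> y - x < \<eta>"
    \<comment> \<open>The coefficient f' (A s) is constant on [x, y], so it can be moved inside the
      integral of b and compared there with f' (A t).\<close>
    obtain s where s: "s \<in> {x..y}" "f (A y) - f (A x) = f' (A s) * (A y - A x)"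
      using mean_value_compose[OF cont f] xy by blast
    have "f (A y) - f (A x) = (LINT t:{x..y}|lebesgue. f' (A s) * b t)"
      using s xy primitive_increment[OF A, of x y] by simp
    then have "f (A y) - f (A x) - (LINT t:{x..y}|lebesgue. f' (A t) * b t)
        = (LINT t:{x..y}|lebesgue. f' (A s) * b t - f' (A t) * b t)"
      using li li1 by (simp add: locally_integrable_Icc set_integral_diff(2) locally_integrable_mult)
    also have "\<bar>\<dots>\<bar> \<le> (LINT t:{x..y}|lebesgue. \<epsilon> * \<bar>b t\<bar>)"
    proof (rule set_integral_abs_le)
      fix t assume t: "t \<in> {x..y}"
      have "\<bar>f' (A s) - f' (A t)\<bar> \<le> \<epsilon>"
        using \<eta>(2)[of s t] s(1) t xy by force
      then show "\<bar>f' (A s) * b t - f' (A t) * b t\<bar> \<le> \<epsilon> * \<bar>b t\<bar>"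
        by (metis abs_ge_zero abs_mult left_diff_distrib mult_right_mono)
    qed (use li li1 li2 in \<open>auto intro!: locally_integrable_mult locally_integrable_diff\<close>)
    finally show "\<bar>f (A y) - f (A x) - (LINT t:{x..y}|lebesgue. f' (A t) * b t)\<bar>
        \<le> \<epsilon> * (LINT t:{x..y}|lebesgue. \<bar>b t\<bar>)"
      by simp
  qed
qed

section \<open>Weak derivatives on the line\<close>

lemma test_function_DERIV:
  assumes "\<phi> \<in> test_functions"
  shows "(\<phi> has_real_derivative deriv \<phi> t) (at t)" "continuous_on UNIV \<phi>" "continuous_on UNIV (deriv \<phi>)"
proof -
  have d: "(deriv ^^ n) \<phi> differentiable_on UNIV" for n
    using assms by (simp add: test_functions_def)
  have "\<phi> differentiable (at t)" for t
    using d[of 0] by (simp add: differentiable_on_def)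
  then show "(\<phi> has_real_derivative deriv \<phi> t) (at t)"
    using DERIV_deriv_iff_real_differentiable by blast
  show "continuous_on UNIV \<phi>" "continuous_on UNIV (deriv \<phi>)"
    using d[of 0] d[of 1] by (auto intro: differentiable_imp_continuous_on)
qed

lemma test_function_support:
  assumes "\<phi> \<in> test_functions"
  shows "\<exists>R>0. (\<forall>t. t \<notin> {-R<..<R} \<longrightarrow> \<phi> t = 0) \<and> (\<forall>t. t \<notin> {-R<..<R} \<longrightarrow> deriv \<phi> t = 0)"
proof -
  have "bounded {t. \<phi> t \<noteq> 0}"
    using assms by (simp add: test_functions_def compact_closure)
  then obtain B where B: "\<And>t. \<phi> t \<noteq> 0 \<Longrightarrow> \<bar>t\<bar> \<le> B"
    by (auto simp: bounded_iff)
  \<comment> \<open>The margin 1 places the complement of (-R, R) inside the open set |t| > |B|, on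
    which \<phi> vanishes identically and therefore its derivative too.\<close>
  define R where "R = \<bar>B\<bar> + 1"
  have out: "\<phi> t = 0" if "\<bar>t\<bar> > \<bar>B\<bar>" for t
    using B[of t] that by fastforce
  have "deriv \<phi> t = 0" if "t \<notin> {-R<..<R}" for t
  proof -
    have "open {t. \<bar>t\<bar> > \<bar>B\<bar>}"
      by (intro open_Collect_less continuous_intros)
    moreover have "t \<in> {t. \<bar>t\<bar> > \<bar>B\<bar>}"
      using that by (auto simp: R_def)
    ultimately have "((\<lambda>_. 0) has_real_derivative deriv \<phi> t) (at t)"
      by (rule has_field_derivative_transform_within_open[OF test_function_DERIV(1)[OF assms]])
         (use out in auto)
    then show ?thesis
      using DERIV_unique DERIV_const by blast
  qed
  moreover have "\<phi> t = 0" if "t \<notin> {-R<..<R}" for t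
    using out[of t] that by (auto simp: R_def)
  moreover have "R > 0" by (simp add: R_def)
  ultimately show ?thesis by blast
qed

lemma C1_primitive:
  assumes "\<And>t. (f has_real_derivative f' t) (at t)" "continuous_on UNIV f'"
  shows "primitive f f'"
  unfolding primitive_def
proof (intro conjI allI impI)
  show li: "locally_integrable f'" using assms(2) by (rule continuous_locally_integrable)
  fix x y :: real assume "x \<le> y"
  have "(f' has_integral (f y - f x)) {x..y}"
    by (rule fundamental_theorem_of_calculus[OF \<open>x \<le> y\<close>])
       (use assms(1) in \<open>auto simp: has_real_derivative_iff_has_vector_derivative[symmetric]
          intro: has_field_derivative_at_within\<close>)
  then show "f y - f x = (LINT t:{x..y}|lebesgue. f' t)"
    using set_lebesgue_integral_eq_integral(2)[OF locally_integrable_Icc[OF li]] integral_unique by metis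
qed

lemma test_function_primitive: "\<phi> \<in> test_functions \<Longrightarrow> primitive \<phi> (deriv \<phi>)"
  using C1_primitive test_function_DERIV by blast

lemma lebesgue_integral_support:
  assumes "\<And>t. t \<notin> {x..y} \<Longrightarrow> h t = (0::real)"
  shows "(LINT t|lebesgue. h t) = (LINT t:{x..y}|lebesgue. h t)"
  unfolding set_lebesgue_integral_def
  by (rule Bochner_Integration.integral_cong) (use assms in \<open>auto simp: indicator_def\<close>)

lemma integrable_support:
  assumes "locally_integrable h" "\<And>t. t \<notin> {x..y} \<Longrightarrow> h t = (0::real)"
  shows "integrable lebesgue h"
proof -
  have "integrable lebesgue (\<lambda>t. indicat_real {x..y} t *\<^sub>R h t)"
    using locally_integrable_Icc[OF assms(1), of x y] by (simp add: set_integrable_def)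
  moreover have "(\<lambda>t. indicat_real {x..y} t *\<^sub>R h t) = h"
    using assms(2) by (auto simp: fun_eq_iff indicator_def)
  ultimately show ?thesis by simp
qed

lemma integrable_mult_test_function:
  assumes "locally_integrable u" "\<phi> \<in> test_functions"
  shows "integrable lebesgue (\<lambda>t. u t * \<phi> t)" "integrable lebesgue (\<lambda>t. u t * deriv \<phi> t)"
proof -
  obtain R where R: "\<And>t. t \<notin> {-R<..<R} \<Longrightarrow> \<phi> t = 0" "\<And>t. t \<notin> {-R<..<R} \<Longrightarrow> deriv \<phi> t = 0"
    using test_function_support[OF assms(2)] by blast
  show "integrable lebesgue (\<lambda>t. u t * \<phi> t)" "integrable lebesgue (\<lambda>t. u t * deriv \<phi> t)"
    by (rule integrable_support[of _ "-R" R];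
        use R in \<open>auto intro!: locally_integrable_mult_continuous assms(1) test_function_DERIV(2,3)[OF assms(2)]\<close>)+
qed

text \<open>Integration by parts: the product rule for G and the test function on [-R, R], where the
  boundary terms vanish.\<close>

lemma primitive_has_weak_deriv:
  assumes G: "primitive G g" shows "has_weak_deriv G g"
  unfolding has_weak_deriv_def
proof (intro conjI ballI)
  show liG: "locally_integrable G"
    by (rule continuous_locally_integrable[OF primitive_continuous[OF G]])
  show lig: "locally_integrable g" by (rule primitive_locally_integrable[OF G])
  fix \<phi> assume \<phi>: "\<phi> \<in> test_functions"
  obtain R where "R > 0" and R: "\<And>t. t \<notin> {-R<..<R} \<Longrightarrow> \<phi> t = 0" "\<And>t. t \<notin> {-R<..<R} \<Longrightarrow> deriv \<phi> t = 0"
    using test_function_support[OF \<phi>] by blast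
  have "(LINT t|lebesgue. G t * deriv \<phi> t + g t * \<phi> t)
      = (LINT t:{-R..R}|lebesgue. G t * deriv \<phi> t + g t * \<phi> t)"
    by (rule lebesgue_integral_support) (auto simp: R)
  also have "\<dots> = G R * \<phi> R - G (-R) * \<phi> (-R)"
    using primitive_increment[OF primitive_times[OF G test_function_primitive[OF \<phi>]], of "-R" R] \<open>R > 0\<close>
    by simp
  also have "\<dots> = 0" by (simp add: R)
  finally show "(LINT t|lebesgue. G t * deriv \<phi> t) = - (LINT t|lebesgue. g t * \<phi> t)"
    using integrable_mult_test_function(2)[OF liG \<phi>] integrable_mult_test_function(1)[OF lig \<phi>]
    by simp
qed

text \<open>The Borel sets over which a truncation of w integrates to 0 include the intervals and
  are closed under complements and countable disjoint unions, so they are all Borel sets. A density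
  that integrates to 0 over every Borel set is 0 almost everywhere.\<close>

lemma locally_integrable_zero_AE:
  assumes li: "locally_integrable w"
    and zero: "\<And>x y. x \<le> y \<Longrightarrow> (LINT t:{x..y}|lebesgue. w t) = 0"
  shows "AE t in lebesgue. w t = 0"
proof -
  have AE_n: "AE t in lebesgue. t \<in> {- real n..real n} \<longrightarrow> w t = 0" for n
  proof -
    define I where "I = {- real n..real n}"
    \<comment> \<open>Truncation makes the function integrable over the whole line, as complements
      and countable unions demand.\<close>
    define v where "v = (\<lambda>t. indicat_real I t * w t)"
    have int_v: "integrable lebesgue v"
      using locally_integrable_Icc[OF li, of "- real n" "real n"] by (simp add: set_integrable_def I_def v_def)
    have setint: "set_integrable lebesgue A v" if "A \<in> sets borel" for A
      unfolding set_integrable_def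
      by (rule integrable_mult_indicator) (use that int_v in auto)
    have Icc: "(LINT t:{a..b}|lebesgue. v t) = 0" for a b
    proof -
      have "(LINT t:{a..b}|lebesgue. v t) = (LINT t:{max a (- real n)..min b (real n)}|lebesgue. w t)"
        unfolding set_lebesgue_integral_def v_def I_def
        by (rule Bochner_Integration.integral_cong) (auto simp: indicator_def)
      also have "\<dots> = 0"
        using zero by (cases "max a (- real n) \<le> min b (real n)") (auto simp: set_lebesgue_integral_def)
      finally show ?thesis .
    qed
    have all0: "(LINT t:A|lebesgue. v t) = 0" if "A \<in> sets borel" for A
      using that
    proof (induction rule: borel_set_induct)
      case empty
      then show ?case by (simp add: set_lebesgue_integral_def)
    next
      case (interval a b)
      then show ?case by (rule_tac Icc)
    next
      case (compl A)
      have "(LINT t:UNIV|lebesgue. v t) = (LINT t:I|lebesgue. v t)"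
        unfolding set_lebesgue_integral_def v_def
        by (rule Bochner_Integration.integral_cong) (auto simp: indicator_def)
      then have "(LINT t:UNIV|lebesgue. v t) = 0"
        by (simp only: I_def Icc)
      moreover have "(LINT t:A \<union> -A|lebesgue. v t) = (LINT t:A|lebesgue. v t) + (LINT t:-A|lebesgue. v t)"
        using compl by (intro set_integral_Un setint) auto
      ultimately show ?case
        using compl by simp
    next
      case (union f)
      have "(LINT t:(\<Union>i. f i)|lebesgue. v t) = (\<Sum>i. (LINT t:f i|lebesgue. v t))"
        by (rule lebesgue_integral_countable_add)
           (use union in \<open>auto simp: disjoint_family_on_def intro!: setint\<close>)
      with union show ?case by simp
    qed
    \<comment> \<open>Vanishing integrals are known for Borel sets only, while
      \<open>lebesgue\<close> has more measurable sets. Uniqueness of densities is therefore applied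
      in \<open>lborel\<close>, to a Borel representative.\<close>
    obtain v' where v': "v' \<in> borel_measurable lborel" "AE t in lborel. v t = v' t"
      using completion_ex_borel_measurable_real[OF borel_measurable_integrable[OF int_v]] by blast
    have v'm: "v' \<in> borel_measurable lebesgue"
      using v'(1) by (rule measurable_completion)
    have AE': "AE t in lebesgue. v t = v' t"
      by (rule AE_completion[OF v'(2)])
    have int_v': "integrable lebesgue v'"
      using integrable_cong_AE[OF borel_measurable_integrable[OF int_v] v'm AE'] int_v by simp
    have "AE t in lborel. v' t = 0"
    proof (rule density_unique_real)
      show "integrable lborel v'"
        using int_v' v'(1) by (simp add: integrable_completion)
      fix A :: "real set" assume A: "A \<in> sets lborel"
      have "(LINT t:A|lborel. v' t) = (LINT t:A|lebesgue. v' t)"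
        unfolding set_lebesgue_integral_def
        by (rule integral_completion[symmetric]) (use A v'(1) in auto)
      also have "\<dots> = (LINT t:A|lebesgue. v t)"
        by (rule set_lebesgue_integral_cong_AE)
           (use A v'm int_v AE' in \<open>auto intro: borel_measurable_integrable\<close>)
      also have "\<dots> = 0" using all0 A by simp
      finally show "(LINT t:A|lborel. v' t) = (LINT t:A|lborel. 0)" by simp
    qed simp
    from AE_completion[OF this] AE' show ?thesis
      by eventually_elim (auto simp: v_def I_def)
  qed
  then have "AE t in lebesgue. \<forall>n. t \<in> {- real n..real n} \<longrightarrow> w t = 0"
    unfolding AE_all_countable by blast
  then show ?thesis
  proof eventually_elim
    case (elim t)
    obtain n :: nat where "\<bar>t\<bar> \<le> real n" using real_arch_simple by blast
    then have "t \<in> {- real n..real n}" by auto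
    with elim show ?case by blast
  qed
qed

lemma integral_plateau_tendsto:
  assumes w: "locally_integrable w"
  shows "(\<lambda>n. LINT t|lebesgue. w t * plateau n x y t) \<longlonglongrightarrow> (LINT t:{x..y}|lebesgue. w t)"
proof -
  have [measurable]: "w \<in> borel_measurable lebesgue"
    by (rule locally_integrable_measurable[OF w])
  have [measurable]: "plateau n x y \<in> borel_measurable lebesgue" for n
    by (rule continuous_lebesgue_measurable[OF flat_alg_continuous[OF plateau_flat_alg]])
  have "(\<lambda>n. LINT t|lebesgue. w t * plateau n x y t) \<longlonglongrightarrow> (LINT t|lebesgue. indicat_real {x..y} t *\<^sub>R w t)"
  proof (rule integral_dominated_convergence)
    show "integrable lebesgue (\<lambda>t. \<bar>indicat_real {x..y} t *\<^sub>R w t\<bar>)"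
      using locally_integrable_Icc[OF w, of x y] by (auto simp: set_integrable_def simp del: real_scaleR_def)
    \<comment> \<open>The cut-offs converge to the indicator of the open interval, the integral is
      over the closed one; the endpoints form a null set.\<close>
    have "AE t in lebesgue. t \<noteq> x" "AE t in lebesgue. t \<noteq> y"
      using AE_completion[OF AE_lborel_singleton] by auto
    then show "AE t in lebesgue. (\<lambda>n. w t * plateau n x y t) \<longlonglongrightarrow> indicat_real {x..y} t *\<^sub>R w t"
    proof eventually_elim
      case (elim t)
      have "(\<lambda>n. w t * plateau n x y t) \<longlonglongrightarrow> w t * indicat_real {x<..<y} t"
        by (intro tendsto_mult tendsto_const plateau_tendsto)
      moreover have "w t * indicat_real {x<..<y} t = indicat_real {x..y} t *\<^sub>R w t"
        using elim by (auto simp: indicator_def)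
      ultimately show ?case by simp
    qed
    show "AE t in lebesgue. norm (w t * plateau n x y t) \<le> \<bar>indicat_real {x..y} t *\<^sub>R w t\<bar>" for n
    proof (rule AE_I2)
      fix t
      show "norm (w t * plateau n x y t) \<le> \<bar>indicat_real {x..y} t *\<^sub>R w t\<bar>"
        using plateau_bounds[of n x y t] plateau_outside[of t x y n]
        by (cases "t \<in> {x<..<y}") (auto simp: abs_mult indicator_def mult_left_le)
    qed
  qed measurable
  then show ?thesis by (simp add: set_lebesgue_integral_def)
qed

text \<open>The fundamental lemma of the calculus of variations: cut-offs are test functions, and in
  the limit they yield the integral of w over any interval.\<close>

lemma test_functions_separate:
  assumes w: "locally_integrable w" and "\<And>\<phi>. \<phi> \<in> test_functions \<Longrightarrow> (LINT t|lebesgue. w t * \<phi> t) = 0"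
  shows "AE t in lebesgue. w t = 0"
proof (rule locally_integrable_zero_AE[OF w])
  fix x y :: real
  show "(LINT t:{x..y}|lebesgue. w t) = 0"
    using integral_plateau_tendsto[OF w, of x y] assms(2)[OF plateau_test_function]
    by (simp add: LIMSEQ_const_iff)
qed

text \<open>The factor \<open>k\<close> makes the total integral vanish, so that the antiderivative has compact support.\<close>

lemma plateau_combination_test_function:
  fixes x y :: real and n :: nat
  defines "k \<equiv> (LINT t|lebesgue. plateau n x y t) / (LINT t|lebesgue. plateau n 0 1 t)"
  shows "\<exists>\<phi>\<in>test_functions. deriv \<phi> = (\<lambda>t. plateau n x y t - k * plateau n 0 1 t)"
proof -
  define f where "f = (\<lambda>t. plateau n x y t + (- k) * plateau n 0 1 t)"
  have f: "f \<in> flat_alg"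
    unfolding f_def
    by (rule flat_alg.add[OF plateau_flat_alg flat_alg.mult[OF flat_alg.const plateau_flat_alg]])
  have contf: "continuous_on A f" for A
    by (rule flat_alg_continuous[OF f])
  have li: "locally_integrable f"
    by (rule continuous_locally_integrable[OF contf])
  have lip: "locally_integrable (plateau n x y)" for x y
    by (rule continuous_locally_integrable[OF flat_alg_continuous[OF plateau_flat_alg]])
  define R where "R = \<bar>x\<bar> + \<bar>y\<bar> + 1"
  have out: "plateau n x y t = 0" "plateau n 0 1 t = 0" if "t \<le> -R \<or> R \<le> t" for t
    using that by (auto intro!: plateau_outside simp: R_def)
  obtain F0 where F0: "primitive F0 f" using primitive_exists[OF li] by blast
  define F where "F t = F0 t - F0 (-R)" for t
  have incr: "F t - F s = integral {s..t} f" if "s \<le> t" for s t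
    using primitive_increment[OF F0 that] set_lebesgue_integral_eq_integral(2)[OF locally_integrable_Icc[OF li]]
    by (simp add: F_def)
  have DF: "(F has_real_derivative f t) (at t)" for t
  proof -
    \<comment> \<open>The window [t - 1, t + 1] has t in its interior, so the derivative within it
      is the two-sided derivative.\<close>
    have 1: "((\<lambda>s. integral {t - 1..s} f) has_real_derivative f t) (at t within {t - 1..t + 1})"
      by (rule integral_has_real_derivative[OF contf]) auto
    have 2: "((\<lambda>s. F (t - 1) + integral {t - 1..s} f) has_real_derivative f t) (at t within {t - 1..t + 1})"
      by (rule DERIV_cong[OF DERIV_add[OF DERIV_const 1]]) simp
    have 3: "F (t - 1) + integral {t - 1..s} f = F s" if "s \<in> {t - 1..t + 1}" for s
    proof -
      have "t - 1 \<le> s" using that by simp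
      from incr[OF this] show ?thesis by linarith
    qed
    have "(F has_real_derivative f t) (at t within {t - 1..t + 1})"
      by (rule has_field_derivative_transform_within[OF 2 zero_less_one _ 3]) auto
    moreover have "at t within {t - 1..t + 1} = at t"
      by (rule at_within_interior) (simp add: interior_atLeastAtMost_real)
    ultimately show ?thesis by simp
  qed
  have J: "integrable lebesgue (plateau n x y)" for x y
  proof -
    have "plateau n x y t = 0" if "t \<notin> {x..y}" for t
      using that by (intro plateau_outside) auto
    from integrable_support[OF lip this] show ?thesis .
  qed
  \<comment> \<open>The quotient \<open>k\<close> cancels the total integral only if its denominator
    is nonzero. A vanishing integral would make a function that is positive on (0, 1) zero almost
    everywhere, and (0, 1) a null set.\<close>
  have pos: "(LINT t|lebesgue. plateau n 0 1 t) > 0"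
  proof (rule ccontr)
    assume "\<not> ?thesis"
    moreover have "(LINT t|lebesgue. plateau n 0 1 t) \<ge> 0"
      by (rule Bochner_Integration.integral_nonneg) (rule plateau_bounds)
    ultimately have "(LINT t|lebesgue. plateau n 0 1 t) = 0" by simp
    then have "AE t in lebesgue. plateau n 0 1 t = 0"
      using integral_nonneg_eq_0_iff_AE[OF J] plateau_bounds(1) by auto
    then have "AE t in lebesgue. t \<notin> {0<..<1::real}"
    proof eventually_elim
      case (elim t)
      then show ?case using plateau_pos[of t 0 1 n] by auto
    qed
    then have "{0<..<1::real} \<in> null_sets lebesgue"
      by (subst AE_iff_null_sets) auto
    then show False
      by (simp add: null_sets_def)
  qed
  have zero_out: "F t = 0" if "t \<notin> {-R..R}" for t
  proof -
    have F0': "F t = F s" if "s \<le> t" "\<And>r. r \<in> {s..t} \<Longrightarrow> f r = 0" for s t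
    proof -
      have "integral {s..t} f = integral {s..t} (\<lambda>_. 0)"
        by (rule Henstock_Kurzweil_Integration.integral_cong) (use that in auto)
      with incr[OF that(1)] show ?thesis by simp
    qed
    have f_out: "f r = 0" if "r \<le> -R \<or> R \<le> r" for r
      using out[OF that] by (simp add: f_def)
    have "F (-R) = 0" by (simp add: F_def)
    moreover have "F R = F (-R)"
    proof -
      have "-R \<le> R" by (simp add: R_def)
      have "F R - F (-R) = (LINT t:{-R..R}|lebesgue. f t)"
        using primitive_increment[OF F0 \<open>-R \<le> R\<close>] by (simp add: F_def)
      also have "\<dots> = (LINT t|lebesgue. f t)"
        by (rule lebesgue_integral_support[symmetric], rule f_out) auto
      also have "\<dots> = (LINT t|lebesgue. plateau n x y t) - k * (LINT t|lebesgue. plateau n 0 1 t)"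
        using J[of x y] J[of 0 1] by (simp add: f_def)
      also have "\<dots> = 0" using pos by (simp add: k_def)
      finally show ?thesis by simp
    qed
    ultimately show ?thesis
    proof (cases "t < -R")
      case True
      then have "F (-R) = F t" by (intro F0' f_out) auto
      with \<open>F (-R) = 0\<close> show ?thesis by simp
    next
      case False
      then have "F t = F R" using that by (intro F0' f_out) auto
      with \<open>F (-R) = 0\<close> \<open>F R = F (-R)\<close> show ?thesis by simp
    qed
  qed
  have "F \<in> test_functions"
    by (rule test_function_primitiveI[OF f DF zero_out])
  moreover have "deriv F = (\<lambda>t. plateau n x y t - k * plateau n 0 1 t)"
    using DERIV_imp_deriv[OF DF] by (auto simp: f_def)
  ultimately show ?thesis by blast
qed

text \<open>Derivatives of test functions have mean zero, so a cut-off of [x, y] is balanced by a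
  multiple of the cut-off of [0, 1]. In the limit the integral of w over [x, y] is y - x times the
  one over [0, 1], hence w - c integrates to 0 over every interval.\<close>

lemma du_Bois_Reymond:
  assumes w: "locally_integrable w"
    and zero: "\<And>\<phi>. \<phi> \<in> test_functions \<Longrightarrow> (LINT t|lebesgue. w t * deriv \<phi> t) = 0"
  shows "\<exists>c. AE t in lebesgue. w t = c"
proof -
  define c where "c = (LINT t:{0..1}|lebesgue. w t)"
  have one: "locally_integrable (\<lambda>_. 1)"
    by (rule continuous_locally_integrable) auto
  have len: "(LINT t:{x..y}|lebesgue. (1::real)) = y - x" if "x \<le> y" for x y :: real
    using that by (simp add: set_lebesgue_integral_def)
  have lenlim: "(\<lambda>n. LINT t|lebesgue. plateau n x y t) \<longlonglongrightarrow> y - x" if "x \<le> y" for x y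
    using integral_plateau_tendsto[OF one, of x y] len[OF that] by simp
  have "(LINT t:{x..y}|lebesgue. w t - c) = 0" if "x \<le> y" for x y
  proof -
    define k where "k n = (LINT t|lebesgue. plateau n x y t) / (LINT t|lebesgue. plateau n 0 1 t)" for n
    have k: "k \<longlonglongrightarrow> y - x"
      unfolding k_def using tendsto_divide[OF lenlim[OF that] lenlim[of 0 1]] by simp
    have "(LINT t|lebesgue. w t * plateau n x y t) - k n * (LINT t|lebesgue. w t * plateau n 0 1 t) = 0" for n
    proof -
      obtain \<phi> where \<phi>: "\<phi> \<in> test_functions" "deriv \<phi> = (\<lambda>t. plateau n x y t - k n * plateau n 0 1 t)"
        using plateau_combination_test_function[of n x y] by (auto simp: k_def)
      have "0 = (LINT t|lebesgue. w t * plateau n x y t - k n * (w t * plateau n 0 1 t))"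
        using zero[OF \<phi>(1)] by (simp add: \<phi>(2) algebra_simps)
      then show ?thesis
        using integrable_mult_test_function(1)[OF w plateau_test_function] by simp
    qed
    moreover have "(\<lambda>n. (LINT t|lebesgue. w t * plateau n x y t) - k n * (LINT t|lebesgue. w t * plateau n 0 1 t))
        \<longlonglongrightarrow> (LINT t:{x..y}|lebesgue. w t) - (y - x) * c"
      unfolding c_def by (intro tendsto_diff tendsto_mult k integral_plateau_tendsto w)
    ultimately have "(LINT t:{x..y}|lebesgue. w t) = (y - x) * c"
      by (simp add: LIMSEQ_const_iff)
    moreover have "(LINT t:{x..y}|lebesgue. w t - c) = (LINT t:{x..y}|lebesgue. w t) - (LINT t:{x..y}|lebesgue. c)"
      by (rule set_integral_diff(2)[OF locally_integrable_Icc[OF w]])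
         (rule locally_integrable_Icc[OF continuous_locally_integrable], simp)
    moreover have "(LINT t:{x..y}|lebesgue. c) = (y - x) * c"
      using that by (simp add: set_lebesgue_integral_def)
    ultimately show ?thesis by simp
  qed
  moreover have "locally_integrable (\<lambda>t. w t - c)"
    by (intro locally_integrable_diff w continuous_locally_integrable) auto
  ultimately have "AE t in lebesgue. w t - c = 0"
    by (intro locally_integrable_zero_AE) auto
  then show ?thesis by auto
qed

text \<open>The difference of u and an indefinite integral of g has weak derivative zero, so it is
  constant almost everywhere. This supplies the continuous representative used for all pointwise
  arguments.\<close>

lemma has_weak_deriv_imp_primitive:
  assumes "has_weak_deriv u g"
  shows "\<exists>U. primitive U g \<and> (AE t in lebesgue. u t = U t)"
proof -
  have u: "locally_integrable u" and g: "locally_integrable g"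
    and ug: "\<And>\<phi>. \<phi> \<in> test_functions \<Longrightarrow> (LINT t|lebesgue. u t * deriv \<phi> t) = - (LINT t|lebesgue. g t * \<phi> t)"
    using assms by (auto simp: has_weak_deriv_def)
  obtain G where G: "primitive G g" using primitive_exists[OF g] by blast
  have wG: "has_weak_deriv G g" by (rule primitive_has_weak_deriv[OF G])
  have liG: "locally_integrable G" using wG by (simp add: has_weak_deriv_def)
  have "\<exists>c. AE t in lebesgue. u t - G t = c"
  proof (rule du_Bois_Reymond)
    show "locally_integrable (\<lambda>t. u t - G t)" using u liG by (rule locally_integrable_diff)
    fix \<phi> assume \<phi>: "\<phi> \<in> test_functions"
    have "(LINT t|lebesgue. (u t - G t) * deriv \<phi> t)
        = (LINT t|lebesgue. u t * deriv \<phi> t) - (LINT t|lebesgue. G t * deriv \<phi> t)"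
      using integrable_mult_test_function(2)[OF u \<phi>] integrable_mult_test_function(2)[OF liG \<phi>]
      by (simp add: left_diff_distrib)
    also have "\<dots> = 0"
      using ug[OF \<phi>] wG \<phi> by (simp add: has_weak_deriv_def)
    finally show "(LINT t|lebesgue. (u t - G t) * deriv \<phi> t) = 0" .
  qed
  then obtain c where c: "AE t in lebesgue. u t - G t = c" by blast
  have "primitive (\<lambda>t. G t + c) g"
    using G by (simp add: primitive_def)
  moreover have "AE t in lebesgue. u t = G t + c"
    using c by eventually_elim simp
  ultimately show ?thesis by blast
qed

text \<open>Makes the choice in \<open>weak_deriv\<close> harmless: any two candidates give the same
  integrals against test functions.\<close>

lemma has_weak_deriv_unique:
  assumes "has_weak_deriv u g" "has_weak_deriv v h" and uv: "AE t in lebesgue. u t = v t"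
  shows "AE t in lebesgue. g t = h t"
proof -
  have li: "locally_integrable g" "locally_integrable h" "locally_integrable u" "locally_integrable v"
    using assms by (auto simp: has_weak_deriv_def)
  have "AE t in lebesgue. g t - h t = 0"
  proof (rule test_functions_separate)
    show "locally_integrable (\<lambda>t. g t - h t)" using li by (intro locally_integrable_diff)
    fix \<phi> assume \<phi>: "\<phi> \<in> test_functions"
    have "(LINT t|lebesgue. u t * deriv \<phi> t) = (LINT t|lebesgue. v t * deriv \<phi> t)"
      using integrable_mult_test_function(2)[OF li(3) \<phi>] integrable_mult_test_function(2)[OF li(4) \<phi>] uv
      by (intro integral_cong_AE) auto
    then have "(LINT t|lebesgue. g t * \<phi> t) = (LINT t|lebesgue. h t * \<phi> t)"
      using assms \<phi> by (simp add: has_weak_deriv_def)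
    then show "(LINT t|lebesgue. (g t - h t) * \<phi> t) = 0"
      using integrable_mult_test_function(1)[OF li(1) \<phi>] integrable_mult_test_function(1)[OF li(2) \<phi>]
      by (simp add: left_diff_distrib)
  qed
  then show ?thesis by eventually_elim simp
qed

section \<open>Weak limits in the space of square integrable functions\<close>

lemma L2_measurable: "u \<in> L2 \<Longrightarrow> u \<in> borel_measurable lebesgue"
  by (simp add: L2_def)

lemma L2_square_integrable: "u \<in> L2 \<Longrightarrow> integrable lebesgue (\<lambda>t. (u t)\<^sup>2)"
  by (simp add: L2_def)

lemma L2_bound:
  assumes "integrable lebesgue f" and [measurable]: "u \<in> borel_measurable lebesgue"
    and "AE t in lebesgue. (u t)\<^sup>2 \<le> f t"
  shows "u \<in> L2"
proof -
  have "integrable lebesgue (\<lambda>t. (u t)\<^sup>2)"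
  proof (rule Bochner_Integration.integrable_bound[OF assms(1)])
    show "AE t in lebesgue. norm ((u t)\<^sup>2) \<le> norm (f t)"
      using assms(3) by eventually_elim simp
  qed measurable
  then show ?thesis by (simp add: L2_def)
qed

lemma L2_add: "u \<in> L2 \<Longrightarrow> v \<in> L2 \<Longrightarrow> (\<lambda>t. u t + v t) \<in> L2"
proof (rule L2_bound[of "\<lambda>t. 2 * (u t)\<^sup>2 + 2 * (v t)\<^sup>2"])
  assume uv: "u \<in> L2" "v \<in> L2"
  then show "integrable lebesgue (\<lambda>t. 2 * (u t)\<^sup>2 + 2 * (v t)\<^sup>2)"
    by (intro Bochner_Integration.integrable_add integrable_mult_right L2_square_integrable)
  show "(\<lambda>t. u t + v t) \<in> borel_measurable lebesgue"
    using uv by (auto simp: L2_def)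
  have "(a + b)\<^sup>2 \<le> 2 * a\<^sup>2 + 2 * b\<^sup>2" for a b :: real
    using zero_le_power2[of "a - b"] by (simp add: power2_eq_square algebra_simps)
  then show "AE t in lebesgue. (u t + v t)\<^sup>2 \<le> 2 * (u t)\<^sup>2 + 2 * (v t)\<^sup>2"
    by simp
qed

lemma L2_cmult: "u \<in> L2 \<Longrightarrow> (\<lambda>t. c * u t) \<in> L2"
  by (auto simp: L2_def power_mult_distrib)

lemma L2_diff: "u \<in> L2 \<Longrightarrow> v \<in> L2 \<Longrightarrow> (\<lambda>t. u t - v t) \<in> L2"
  using L2_add[of u "\<lambda>t. -1 * v t"] L2_cmult[of v "-1"] by simp

lemma L2_integrable_mult:
  assumes "u \<in> L2" "v \<in> L2" shows "integrable lebesgue (\<lambda>t. u t * v t)"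
proof (rule Bochner_Integration.integrable_bound)
  show "integrable lebesgue (\<lambda>t. (u t)\<^sup>2 + (v t)\<^sup>2)"
    using assms by (intro Bochner_Integration.integrable_add L2_square_integrable)
  show "(\<lambda>t. u t * v t) \<in> borel_measurable lebesgue"
    using assms by (auto simp: L2_def)
  have "\<bar>a * b\<bar> \<le> a\<^sup>2 + b\<^sup>2" for a b :: real
  proof -
    have "2 * \<bar>a * b\<bar> \<le> a\<^sup>2 + b\<^sup>2"
      using sum_squares_bound[of "\<bar>a\<bar>" "\<bar>b\<bar>"] by (simp add: abs_mult)
    then show ?thesis by linarith
  qed
  then show "AE t in lebesgue. norm (u t * v t) \<le> norm ((u t)\<^sup>2 + (v t)\<^sup>2)"
    by simp
qed

text \<open>Fatou's lemma for Bochner integrals. Integrability of q belongs to the conclusion: for a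
  non-integrable q the integral would be 0 by default and the bound would say nothing.\<close>

lemma Fatou_nonneg:
  fixes p :: "nat \<Rightarrow> 'a \<Rightarrow> real"
  assumes int: "\<And>n. integrable M (p n)" and nn: "\<And>n. AE x in M. 0 \<le> p n x"
    and q[measurable]: "q \<in> borel_measurable M"
    and lim: "AE x in M. (\<lambda>n. p n x) \<longlonglongrightarrow> q x"
    and le: "\<And>n. integral\<^sup>L M (p n) \<le> c n" and c: "c \<longlonglongrightarrow> C"
  shows "integrable M q \<and> integral\<^sup>L M q \<le> C"
proof -
  have [measurable]: "p n \<in> borel_measurable M" for n using int by auto
  have nn': "AE x in M. \<forall>n. 0 \<le> p n x" using nn unfolding AE_all_countable by blast
  have "AE x in M. 0 \<le> q x"
    using nn' lim by eventually_elim (rule LIMSEQ_le_const, auto)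
  have "0 \<le> c n" for n
    using order_trans[OF integral_nonneg_AE[OF nn[of n]] le[of n]] .
  then have "0 \<le> C" using c by (intro LIMSEQ_le_const[OF c]) auto
  have "(\<integral>\<^sup>+x. ennreal (q x) \<partial>M) = (\<integral>\<^sup>+x. liminf (\<lambda>n. ennreal (p n x)) \<partial>M)"
  proof (rule nn_integral_cong_AE, use lim in eventually_elim)
    fix x assume "(\<lambda>n. p n x) \<longlonglongrightarrow> q x"
    then have "(\<lambda>n. ennreal (p n x)) \<longlonglongrightarrow> ennreal (q x)" by (rule tendsto_ennrealI)
    then show "ennreal (q x) = liminf (\<lambda>n. ennreal (p n x))"
      by (intro lim_imp_Liminf[symmetric]) auto
  qed
  also have "\<dots> \<le> liminf (\<lambda>n. \<integral>\<^sup>+x. ennreal (p n x) \<partial>M)"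
    by (rule nn_integral_liminf) auto
  also have "\<dots> \<le> liminf (\<lambda>n. ennreal (c n))"
    using int nn le by (intro Liminf_mono always_eventually allI) (simp add: nn_integral_eq_integral ennreal_leI)
  also have "\<dots> = ennreal C"
    using tendsto_ennrealI[OF c] by (intro lim_imp_Liminf) auto
  finally have *: "(\<integral>\<^sup>+x. ennreal (q x) \<partial>M) \<le> ennreal C" .
  have int_q: "integrable M q"
    by (rule integrableI_nonneg[OF q \<open>AE x in M. 0 \<le> q x\<close>]) (use * in \<open>auto intro: le_less_trans\<close>)
  with * \<open>0 \<le> C\<close> \<open>AE x in M. 0 \<le> q x\<close> show ?thesis
    by (simp add: nn_integral_eq_integral)
qed

text \<open>The Cauchy-Schwarz inequality against a constant, obtained from the nonnegative variance
  of u about its mean c / l. It turns bounds on derivatives into Hoelder bounds.\<close>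

lemma interval_integral_square_le:
  assumes u: "u \<in> L2" and "x \<le> y"
  shows "(LINT t:{x..y}|lebesgue. u t)\<^sup>2 \<le> (y - x) * (LINT t|lebesgue. (u t)\<^sup>2)"
proof (cases "x = y")
  case False
  define l where "l = y - x"
  have "l > 0" using False \<open>x \<le> y\<close> by (simp add: l_def)
  define c where "c = (LINT t:{x..y}|lebesgue. u t)"
  define I where "I = (LINT t:{x..y}|lebesgue. (u t)\<^sup>2)"
  have iu: "set_integrable lebesgue {x..y} u"
    by (rule locally_integrable_Icc[OF L2_locally_integrable[OF u]])
  have iu2: "set_integrable lebesgue {x..y} (\<lambda>t. (u t)\<^sup>2)"
    unfolding set_integrable_def by (rule integrable_mult_indicator) (use u in \<open>auto simp: L2_def\<close>)
  have i1: "set_integrable lebesgue {x..y} (\<lambda>t. d)" for d :: real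
    by (rule locally_integrable_Icc[OF continuous_locally_integrable]) auto
  have len: "(LINT t:{x..y}|lebesgue. d) = l * d" for d :: real
    using \<open>x \<le> y\<close> by (simp add: set_lebesgue_integral_def l_def)
  have "0 \<le> (LINT t:{x..y}|lebesgue. (u t - c / l)\<^sup>2)"
    unfolding set_lebesgue_integral_def by (rule Bochner_Integration.integral_nonneg) auto
  also have "\<dots> = (LINT t:{x..y}|lebesgue. ((u t)\<^sup>2 - (2 * c / l) * u t) + (c / l)\<^sup>2)"
    by (simp add: power2_diff algebra_simps)
  also have "\<dots> = I - (2 * c / l) * c + l * (c / l)\<^sup>2"
    by (subst set_integral_add(2), use iu iu2 i1 in force, rule i1, subst set_integral_diff(2), rule iu2)
       (use iu len in \<open>auto simp: I_def c_def\<close>)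
  also have "\<dots> = I - c\<^sup>2 / l"
    using \<open>l > 0\<close> by (simp add: power2_eq_square field_simps)
  finally have "c\<^sup>2 \<le> l * I" using \<open>l > 0\<close> by (simp add: field_simps)
  also have "I \<le> (LINT t|lebesgue. (u t)\<^sup>2)"
    unfolding I_def set_lebesgue_integral_def
    by (rule integral_mono) (use iu2 u in \<open>auto simp: set_integrable_def L2_def indicator_def\<close>)
  finally show ?thesis using \<open>l > 0\<close> by (simp add: c_def l_def)
qed simp

text \<open>The core of the Riesz-Fischer theorem. The rate \<open>(1 / 4) ^ n\<close> leaves room
  for the weight \<open>2 ^ n\<close>, after which the integrals are still summable.\<close>

lemma L2_AE_convergent:
  assumes h: "\<And>n. h n \<in> L2" and fast: "\<And>n. (LINT t|lebesgue. (h (Suc n) t - h n t)\<^sup>2) \<le> (1 / 4) ^ n"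
  shows "AE t in lebesgue. convergent (\<lambda>n. h n t)"
proof -
  have [measurable]: "h n \<in> borel_measurable lebesgue" for n
    using h by (rule L2_measurable)
  \<comment> \<open>\<open>\<Sum>n. q n\<close> is integrable, hence finite almost everywhere, which forces \<open>\<bar>h (Suc n) - h n\<bar> \<le> 2\<^bsup>-n/2\<^esup>\<close> eventually\<close>
  define q where "q n t = 2 ^ n * (h (Suc n) t - h n t)\<^sup>2" for n t
  have [measurable]: "q n \<in> borel_measurable lebesgue" for n
    unfolding q_def by measurable
  have int_q: "integrable lebesgue (q n)" for n
    unfolding q_def by (intro integrable_mult_right L2_square_integrable L2_diff h)
  have q_nn: "0 \<le> q n t" for n t by (simp add: q_def)
  have "(\<integral>\<^sup>+t. (\<Sum>n. ennreal (q n t)) \<partial>lebesgue) = (\<Sum>n. \<integral>\<^sup>+t. ennreal (q n t) \<partial>lebesgue)"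
    by (rule nn_integral_suminf) measurable
  also have "\<dots> \<le> (\<Sum>n. ennreal ((1 / 2) ^ n))"
  proof (rule suminf_le)
    fix n
    have "integral\<^sup>L lebesgue (q n) \<le> 2 ^ n * (1 / 4) ^ n"
      unfolding q_def using fast[of n] by simp
    also have "\<dots> = (1 / 2) ^ n"
      by (simp add: power_mult_distrib[symmetric])
    finally show "(\<integral>\<^sup>+t. ennreal (q n t) \<partial>lebesgue) \<le> ennreal ((1 / 2) ^ n)"
      using int_q q_nn by (simp add: nn_integral_eq_integral ennreal_leI)
  qed auto
  also have "\<dots> < top"
    by (simp add: suminf_ennreal2 summable_geometric)
  finally have "AE t in lebesgue. (\<Sum>n. ennreal (q n t)) \<noteq> top"
    by (intro nn_integral_PInf_AE[unfolded infinity_ennreal_def]) auto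
  then show ?thesis
  proof eventually_elim
    case (elim t)
    then have "summable (\<lambda>n. q n t)"
      using q_nn by (intro summable_suminf_not_top) auto
    then have "(\<lambda>n. q n t) \<longlonglongrightarrow> 0" by (rule summable_LIMSEQ_zero)
    then have ev: "\<forall>\<^sub>F n in sequentially. q n t < 1"
      by (rule order_tendstoD) simp
    have "summable (\<lambda>n. h (Suc n) t - h n t)"
    proof (rule summable_comparison_test_ev)
      show "\<forall>\<^sub>F n in sequentially. norm (h (Suc n) t - h n t) \<le> (1 / sqrt 2) ^ n"
        using ev
      proof eventually_elim
        case (elim n)
        have "(h (Suc n) t - h n t)\<^sup>2 \<le> ((1 / sqrt 2) ^ n)\<^sup>2"
        proof -
          have "((1 / sqrt 2) ^ n)\<^sup>2 = ((1 / sqrt 2)\<^sup>2) ^ n"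
            unfolding power_mult[symmetric] by (simp only: mult.commute)
          also have "\<dots> = (1 / 2 :: real) ^ n"
            by (simp add: power_divide)
          finally have "((1 / sqrt 2) ^ n)\<^sup>2 = (1 / 2 :: real) ^ n" .
          moreover have "(2::real) ^ n * (1 / 2) ^ n = 1"
            by (simp add: power_mult_distrib[symmetric])
          ultimately show ?thesis
            using elim by (simp add: q_def field_simps)
        qed
        then show ?case
          using power2_le_iff_abs_le[of "(1 / sqrt 2) ^ n" "h (Suc n) t - h n t"] by simp
      qed
      show "summable (\<lambda>n. (1 / sqrt 2) ^ n)"
        by (rule summable_geometric) simp
    qed
    then have "convergent (\<lambda>n. \<Sum>k<n. h (Suc k) t - h k t)"
      by (simp add: summable_iff_convergent)
    then have "convergent (\<lambda>n. h 0 t + (\<Sum>k<n. h (Suc k) t - h k t))"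
      by (intro convergent_add convergent_const)
    then show ?case
      using sum_lessThan_telescope[of "\<lambda>k. h k t"] by simp
  qed
qed

lemma L2_parallelogram:
  assumes "u \<in> L2" "v \<in> L2"
  shows "(LINT t|lebesgue. (u t - v t)\<^sup>2)
    = 2 * (LINT t|lebesgue. (u t)\<^sup>2) + 2 * (LINT t|lebesgue. (v t)\<^sup>2)
      - 4 * (LINT t|lebesgue. ((u t + v t) / 2)\<^sup>2)"
proof -
  have uv: "(\<lambda>t. (u t + v t) / 2) \<in> L2"
    using L2_cmult[OF L2_add[OF assms], of "1 / 2"] by simp
  have "(LINT t|lebesgue. (u t - v t)\<^sup>2)
    = (LINT t|lebesgue. (2 * (u t)\<^sup>2 + 2 * (v t)\<^sup>2) - 4 * ((u t + v t) / 2)\<^sup>2)"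
    by (rule Bochner_Integration.integral_cong) (auto simp: power2_eq_square field_simps)
  also have "\<dots> = 2 * (LINT t|lebesgue. (u t)\<^sup>2) + 2 * (LINT t|lebesgue. (v t)\<^sup>2)
      - 4 * (LINT t|lebesgue. ((u t + v t) / 2)\<^sup>2)"
    using L2_square_integrable[OF assms(1)] L2_square_integrable[OF assms(2)] L2_square_integrable[OF uv]
    by (simp del: power_divide)
  finally show ?thesis .
qed

text \<open>As in the projection theorem: for n \<le> m the midpoint of two near-minimizers of K n
  and K m lies in K n, so its squared norm is at least d n, and the parallelogram identity makes the
  two close. The infima d n increase and are bounded by \<alpha>, hence converge. The sets are not
  assumed closed, so the conclusion keeps approximants h n in K n of the limit f.\<close>

lemma L2_midpoint_convex_limit:
  fixes K :: "nat \<Rightarrow> (real \<Rightarrow> real) set"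
  assumes sub: "\<And>n. K n \<subseteq> L2" and anti: "\<And>n. K (Suc n) \<subseteq> K n"
    and mid: "\<And>n u v. u \<in> K n \<Longrightarrow> v \<in> K n \<Longrightarrow> (\<lambda>t. (u t + v t) / 2) \<in> K n"
    and small: "\<And>n \<epsilon>. \<epsilon> > 0 \<Longrightarrow> \<exists>u\<in>K n. (LINT t|lebesgue. (u t)\<^sup>2) \<le> \<alpha> + \<epsilon>"
  shows "\<exists>f h. f \<in> L2 \<and> (LINT t|lebesgue. (f t)\<^sup>2) \<le> \<alpha> \<and> (\<forall>n. h n \<in> K n) \<and>
    (\<lambda>n. LINT t|lebesgue. (f t - h n t)\<^sup>2) \<longlonglongrightarrow> 0"
proof -
  define N where "N u = (LINT t|lebesgue. (u t)\<^sup>2)" for u :: "real \<Rightarrow> real"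
  have N_nn: "0 \<le> N u" for u by (simp add: N_def)
  have anti': "K n \<subseteq> K m" if "m \<le> n" for m n
    using lift_Suc_antimono_le[of K, OF anti that] .
  define d where "d n = Inf (N ` K n)" for n
  have bdd: "bdd_below (N ` K n)" for n
    by (rule bdd_belowI[of _ 0]) (use N_nn in auto)
  have ne: "N ` K n \<noteq> {}" for n using small[of 1 n] by auto
  have d_le: "d n \<le> N u" if "u \<in> K n" for u n
    unfolding d_def using bdd that by (auto intro: cInf_lower)
  have d_alpha: "d n \<le> \<alpha>" for n
  proof (rule field_le_epsilon)
    fix \<epsilon> :: real assume "\<epsilon> > 0"
    from small[OF this, of n] obtain u where "u \<in> K n" "N u \<le> \<alpha> + \<epsilon>" by (auto simp: N_def)
    with d_le[of u n] show "d n \<le> \<alpha> + \<epsilon>" by simp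
  qed
  have "incseq d"
    unfolding d_def by (intro incseq_SucI cInf_superset_mono ne bdd image_mono anti)
  then obtain D where D: "d \<longlonglongrightarrow> D" "\<And>n. d n \<le> D"
    using incseq_convergent[of d \<alpha>] d_alpha by blast
  have "D \<le> \<alpha>" using D(1) d_alpha by (intro LIMSEQ_le_const2[OF D(1)]) auto
  define e where "e n = inverse (real (Suc n))" for n
  have e_pos: "e n > 0" for n by (simp add: e_def)
  have e_anti: "e m \<le> e n" if "n \<le> m" for m n
    unfolding e_def using that by (intro le_imp_inverse_le) auto
  have e0: "e \<longlonglongrightarrow> 0" unfolding e_def by (rule LIMSEQ_inverse_real_of_nat)
  have "\<exists>u\<in>K n. N u < d n + e n" for n
    using cInf_lessD[OF ne[of n], of "d n + e n"] e_pos[of n] by (auto simp: d_def)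
  then obtain g where g: "\<And>n. g n \<in> K n" "\<And>n. N (g n) < d n + e n"
    by metis
  \<comment> \<open>The parallelogram identity gives 2 (d m - d n) + 2 e m + 2 e n; here d m is
    replaced by its limit D and e m by e n.\<close>
  define \<theta> where "\<theta> n = 2 * (D - d n) + 4 * e n" for n
  have close: "N (\<lambda>t. g m t - g n t) \<le> \<theta> n" if "n \<le> m" for n m
  proof -
    have gm: "g m \<in> K n" using g(1) anti'[OF that] by auto
    have "N (\<lambda>t. g m t - g n t) = 2 * N (g m) + 2 * N (g n) - 4 * N (\<lambda>t. (g m t + g n t) / 2)"
      unfolding N_def by (rule L2_parallelogram) (use g(1) sub in auto)
    also have "\<dots> \<le> 2 * N (g m) + 2 * N (g n) - 4 * d n"
      using d_le[OF mid[OF gm g(1)]] by simp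
    also have "\<dots> \<le> 2 * (d m + e m) + 2 * (d n + e n) - 4 * d n"
      using g(2)[of m] g(2)[of n] by (intro diff_mono add_mono mult_left_mono) auto
    also have "\<dots> \<le> \<theta> n"
    proof -
      from e_anti[OF that] D(2)[of m] show ?thesis
        unfolding \<theta>_def by (simp add: algebra_simps)
    qed
    finally show ?thesis .
  qed
  have "\<theta> \<longlonglongrightarrow> 2 * (D - D) + 4 * 0"
    unfolding \<theta>_def by (intro tendsto_intros D e0)
  then have \<theta>0: "\<theta> \<longlonglongrightarrow> 0" by simp
  have "\<exists>s. \<forall>n\<ge>s. \<theta> n \<le> (1 / 4) ^ k" for k
    using order_tendstoD(2)[OF \<theta>0, of "(1 / 4) ^ k"] by (fastforce simp: eventually_sequentially)
  then obtain s where s: "\<And>k n. n \<ge> s k \<Longrightarrow> \<theta> n \<le> (1 / 4) ^ k" by metis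
  \<comment> \<open>The sum makes r monotone and at least s k, the summand k makes it at least k.
    Hence h k lies in K k and h has the rate required by \<open>L2_AE_convergent\<close>.\<close>
  define r where "r k = k + (\<Sum>i\<le>k. s i)" for k
  have r_s: "s k \<le> r k" and r_ge: "k \<le> r k" for k
    by (auto simp: r_def intro: trans_le_add2 member_le_sum)
  have "mono r" by (rule incseq_SucI[THEN monoI[OF incseqD]]) (simp add: r_def)
  then have r_mono: "r n \<le> r m" if "n \<le> m" for n m using that by (simp add: monoD)
  define h where "h k = g (r k)" for k
  have hK: "h k \<in> K k" for k using g(1)[of "r k"] anti'[OF r_ge[of k]] by (auto simp: h_def)
  have hL2: "h k \<in> L2" for k using hK sub by auto
  have hclose: "N (\<lambda>t. h m t - h n t) \<le> (1 / 4) ^ n" if "n \<le> m" for n m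
    unfolding h_def using close[OF r_mono[OF that]] s[OF r_s[of n]] by (rule order_trans)
  have [measurable]: "h n \<in> borel_measurable lebesgue" for n
    using hL2 by (rule L2_measurable)
  define f where "f t = lim (\<lambda>n. h n t)" for t
  have [measurable]: "f \<in> borel_measurable lebesgue"
    unfolding f_def by (rule borel_measurable_lim_metric) measurable
  have "AE t in lebesgue. convergent (\<lambda>n. h n t)"
    by (rule L2_AE_convergent[OF hL2]) (use hclose[of n "Suc n" for n] in \<open>simp add: N_def\<close>)
  then have lim: "AE t in lebesgue. (\<lambda>n. h n t) \<longlonglongrightarrow> f t"
    by eventually_elim (simp add: f_def convergent_LIMSEQ_iff)
  have "integrable lebesgue (\<lambda>t. (f t)\<^sup>2) \<and> (LINT t|lebesgue. (f t)\<^sup>2) \<le> \<alpha> + 0"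
  proof (rule Fatou_nonneg)
    show "AE t in lebesgue. (\<lambda>n. (h n t)\<^sup>2) \<longlonglongrightarrow> (f t)\<^sup>2"
      using lim by eventually_elim (rule tendsto_power)
    show "(LINT t|lebesgue. (h n t)\<^sup>2) \<le> \<alpha> + e n" for n
    proof -
      have "e (r n) \<le> e n"
        by (rule e_anti[OF r_ge])
      then show ?thesis using g(2)[of "r n"] d_alpha[of "r n"] by (simp add: h_def N_def)
    qed
    show "(\<lambda>n. \<alpha> + e n) \<longlonglongrightarrow> \<alpha> + 0"
      by (intro tendsto_intros e0)
  qed (use hL2 in \<open>auto simp: L2_def\<close>)
  then have f: "f \<in> L2" "N f \<le> \<alpha>" by (auto simp: L2_def N_def)
  \<comment> \<open>Fatou's lemma with n fixed, the later index of the Cauchy estimate tending to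
    infinity.\<close>
  have fh: "N (\<lambda>t. f t - h n t) \<le> (1 / 4) ^ n" for n
  proof -
    have "integrable lebesgue (\<lambda>t. (f t - h n t)\<^sup>2) \<and> (LINT t|lebesgue. (f t - h n t)\<^sup>2) \<le> (1 / 4) ^ n"
    proof (rule Fatou_nonneg)
      show "AE t in lebesgue. (\<lambda>k. (h (k + n) t - h n t)\<^sup>2) \<longlonglongrightarrow> (f t - h n t)\<^sup>2"
        using lim by eventually_elim (intro tendsto_power tendsto_diff tendsto_const LIMSEQ_ignore_initial_segment)
      show "(LINT t|lebesgue. (h (k + n) t - h n t)\<^sup>2) \<le> (1 / 4) ^ n" for k
        using hclose[of n "k + n"] by (simp add: N_def)
      show "integrable lebesgue (\<lambda>t. (h (k + n) t - h n t)\<^sup>2)" for k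
        by (intro L2_square_integrable L2_diff hL2)
    qed auto
    then show ?thesis by (simp add: N_def)
  qed
  have "(\<lambda>n. N (\<lambda>t. f t - h n t)) \<longlonglongrightarrow> 0"
  proof (rule tendsto_sandwich[of "\<lambda>_. 0" _ _ "\<lambda>n. (1 / 4) ^ n"])
    show "(\<lambda>n. (1 / 4 :: real) ^ n) \<longlonglongrightarrow> 0" by (rule LIMSEQ_power_zero) simp
  qed (use N_nn fh in auto)
  with f hK show ?thesis unfolding N_def by blast
qed

text \<open>Replaces weak compactness together with weak lower semicontinuity of the norm.
  Convergence is tested on indicators of intervals only, and this is enough to recognize the limit
  as the derivative of \<Phi>.\<close>

lemma primitive_weak_limit:
  assumes f: "\<And>n. f n \<in> L2" and \<alpha>: "(\<lambda>n. LINT t|lebesgue. (f n t)\<^sup>2) \<longlonglongrightarrow> \<alpha>"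
    and \<Phi>: "\<And>x y. x \<le> y \<Longrightarrow> (\<lambda>n. LINT t:{x..y}|lebesgue. f n t) \<longlonglongrightarrow> \<Phi> y - \<Phi> x"
  shows "\<exists>g\<in>L2. primitive \<Phi> g \<and> (LINT t|lebesgue. (g t)\<^sup>2) \<le> \<alpha>"
proof -
  define E where "E u x y = \<bar>(LINT t:{x..y}|lebesgue. u t) - (\<Phi> y - \<Phi> x)\<bar>" for u x y
  \<comment> \<open>a convex substitute for the closed convex hull of the tail \<open>f N, f (N + 1), \<dots>\<close>\<close>
  define K where "K N = {u \<in> L2. \<forall>x y \<epsilon>. x \<le> y \<longrightarrow> (\<forall>n\<ge>N. E (f n) x y \<le> \<epsilon>) \<longrightarrow> E u x y \<le> \<epsilon>}" for N
  have "\<exists>g h. g \<in> L2 \<and> (LINT t|lebesgue. (g t)\<^sup>2) \<le> \<alpha> \<and> (\<forall>n. h n \<in> K n) \<and>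
    (\<lambda>n. LINT t|lebesgue. (g t - h n t)\<^sup>2) \<longlonglongrightarrow> 0"
  proof (rule L2_midpoint_convex_limit)
    show "K n \<subseteq> L2" "K (Suc n) \<subseteq> K n" for n by (auto simp: K_def)
    show "(\<lambda>t. (u t + v t) / 2) \<in> K n" if uv: "u \<in> K n" "v \<in> K n" for n u v
    proof -
      have L: "u \<in> L2" "v \<in> L2" using uv by (auto simp: K_def)
      have "E (\<lambda>t. (u t + v t) / 2) x y \<le> \<epsilon>" if "E u x y \<le> \<epsilon>" "E v x y \<le> \<epsilon>" for x y \<epsilon>
      proof -
        have "(LINT t:{x..y}|lebesgue. (u t + v t) / 2)
            = ((LINT t:{x..y}|lebesgue. u t) + (LINT t:{x..y}|lebesgue. v t)) / 2"
          using L by (simp add: set_integral_add(2) locally_integrable_Icc L2_locally_integrable)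
        with that show ?thesis unfolding E_def by (simp add: abs_le_iff field_simps)
      qed
      moreover have "(\<lambda>t. (u t + v t) / 2) \<in> L2"
        using L2_cmult[OF L2_add[OF L], of "1 / 2"] by simp
      ultimately show ?thesis using uv by (auto simp: K_def)
    qed
    show "\<exists>u\<in>K n. (LINT t|lebesgue. (u t)\<^sup>2) \<le> \<alpha> + \<epsilon>" if "\<epsilon> > 0" for n \<epsilon>
    proof -
      have "\<forall>\<^sub>F k in sequentially. (LINT t|lebesgue. (f k t)\<^sup>2) < \<alpha> + \<epsilon>"
        using \<open>\<epsilon> > 0\<close> by (intro order_tendstoD(2)[OF \<alpha>]) simp
      with eventually_ge_at_top[of n]
      have "\<forall>\<^sub>F k in sequentially. n \<le> k \<and> (LINT t|lebesgue. (f k t)\<^sup>2) < \<alpha> + \<epsilon>"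
        by eventually_elim simp
      then obtain k where "n \<le> k" "(LINT t|lebesgue. (f k t)\<^sup>2) < \<alpha> + \<epsilon>"
        by (auto simp: eventually_sequentially)
      then show ?thesis using f by (intro bexI[of _ "f k"]) (auto simp: K_def)
    qed
  qed
  then obtain g h where g: "g \<in> L2" "(LINT t|lebesgue. (g t)\<^sup>2) \<le> \<alpha>" and h: "\<And>n. h n \<in> K n"
    and gh: "(\<lambda>n. LINT t|lebesgue. (g t - h n t)\<^sup>2) \<longlonglongrightarrow> 0" by blast
  have hL2: "h n \<in> L2" for n using h by (auto simp: K_def)
  have "\<Phi> y - \<Phi> x = (LINT t:{x..y}|lebesgue. g t)" if xy: "x \<le> y" for x y
  \<comment> \<open>The interval integrals of h n converge to the increment of \<Phi> because h n
    inherits the error bounds of the tail, and to the integral of g by convergence in L2 and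
    Cauchy-Schwarz.\<close>
  proof (rule LIMSEQ_unique)
    show "(\<lambda>n. LINT t:{x..y}|lebesgue. h n t) \<longlonglongrightarrow> \<Phi> y - \<Phi> x"
    proof (rule LIMSEQ_I)
      fix r :: real assume "r > 0"
      obtain N where N: "\<And>n. n \<ge> N \<Longrightarrow> E (f n) x y \<le> r / 2"
        using LIMSEQ_D[OF \<Phi>[OF xy], of "r / 2"] \<open>r > 0\<close> by (force simp: E_def)
      have "E (h n) x y \<le> r / 2" if "n \<ge> N" for n
      proof -
        have "\<forall>k\<ge>n. E (f k) x y \<le> r / 2" using N that by auto
        with h[of n] xy show ?thesis unfolding K_def by blast
      qed
      then show "\<exists>no. \<forall>n\<ge>no. norm ((LINT t:{x..y}|lebesgue. h n t) - (\<Phi> y - \<Phi> x)) < r"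
        using \<open>r > 0\<close> by (intro exI[of _ N]) (force simp: E_def)
    qed
    have "(\<lambda>n. (LINT t:{x..y}|lebesgue. g t - h n t)) \<longlonglongrightarrow> 0"
    proof (rule tendsto_0_le[where K = 1])
      show "(\<lambda>n. sqrt ((y - x) * (LINT t|lebesgue. (g t - h n t)\<^sup>2))) \<longlonglongrightarrow> 0"
        using tendsto_real_sqrt[OF tendsto_mult[OF tendsto_const[of "y - x"] gh]] by simp
      have "\<bar>LINT t:{x..y}|lebesgue. g t - h n t\<bar> \<le> sqrt ((y - x) * (LINT t|lebesgue. (g t - h n t)\<^sup>2))" for n
        using real_sqrt_le_mono[OF interval_integral_square_le[OF L2_diff[OF g(1) hL2] xy]] by simp
      then show "\<forall>\<^sub>F n in sequentially. norm (LINT t:{x..y}|lebesgue. g t - h n t)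
          \<le> norm (sqrt ((y - x) * (LINT t|lebesgue. (g t - h n t)\<^sup>2))) * 1"
        by (intro always_eventually allI) (simp, meson abs_ge_self order_trans)
    qed
    then have "(\<lambda>n. (LINT t:{x..y}|lebesgue. g t) - (LINT t:{x..y}|lebesgue. h n t)) \<longlonglongrightarrow> 0"
      using g(1) hL2 by (simp add: set_integral_diff(2) locally_integrable_Icc L2_locally_integrable)
    from tendsto_diff[OF tendsto_const[of "LINT t:{x..y}|lebesgue. g t"] this]
    show "(\<lambda>n. LINT t:{x..y}|lebesgue. h n t) \<longlonglongrightarrow> (LINT t:{x..y}|lebesgue. g t)"
      by simp
  qed
  then have "primitive \<Phi> g"
    using L2_locally_integrable[OF g(1)] by (simp add: primitive_def)
  with g show ?thesis by blast
qed

section \<open>Sobolev functions and elementary estimates\<close>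

lemma locally_integrable_cong_AE:
  assumes "locally_integrable u" "AE t in lebesgue. u t = v t" "v \<in> borel_measurable lebesgue"
  shows "locally_integrable v"
proof (rule locally_integrable_bound[OF locally_integrable_abs[OF assms(1)] assms(3)])
  show "AE t in lebesgue. t \<in> {- R..R} \<longrightarrow> \<bar>v t\<bar> \<le> \<bar>u t\<bar>" for R
    using assms(2) by eventually_elim simp
qed

lemma has_weak_deriv_cong_AE:
  assumes "has_weak_deriv u g"
    and uv: "AE t in lebesgue. u t = v t" "v \<in> borel_measurable lebesgue"
    and gh: "AE t in lebesgue. g t = h t" "h \<in> borel_measurable lebesgue"
  shows "has_weak_deriv v h"
proof -
  have li: "locally_integrable u" "locally_integrable g"
    using assms by (auto simp: has_weak_deriv_def)
  have li': "locally_integrable v" "locally_integrable h"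
    by (rule locally_integrable_cong_AE[OF li(1) uv], rule locally_integrable_cong_AE[OF li(2) gh])
  show ?thesis
    unfolding has_weak_deriv_def
  proof (intro conjI ballI li')
    fix \<phi> assume \<phi>: "\<phi> \<in> test_functions"
    have "(LINT t|lebesgue. v t * deriv \<phi> t) = (LINT t|lebesgue. u t * deriv \<phi> t)"
    proof (rule integral_cong_AE)
      show "AE t in lebesgue. v t * deriv \<phi> t = u t * deriv \<phi> t"
        using uv(1) by eventually_elim simp
    qed (intro borel_measurable_integrable integrable_mult_test_function li li' \<phi>)+
    also have "\<dots> = - (LINT t|lebesgue. g t * \<phi> t)"
      using assms(1) \<phi> by (simp add: has_weak_deriv_def)
    also have "(LINT t|lebesgue. g t * \<phi> t) = (LINT t|lebesgue. h t * \<phi> t)"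
    proof (rule integral_cong_AE)
      show "AE t in lebesgue. g t * \<phi> t = h t * \<phi> t"
        using gh(1) by eventually_elim simp
    qed (intro borel_measurable_integrable integrable_mult_test_function li li' \<phi>)+
    finally show "(LINT t|lebesgue. v t * deriv \<phi> t) = - (LINT t|lebesgue. h t * \<phi> t)" .
  qed
qed

lemma has_weak_deriv_add_mult:
  assumes u: "has_weak_deriv u g" and v: "has_weak_deriv v h"
  shows "has_weak_deriv (\<lambda>t. u t + c * v t) (\<lambda>t. g t + c * h t)"
proof -
  obtain U where U: "primitive U g" "AE t in lebesgue. u t = U t"
    using has_weak_deriv_imp_primitive[OF u] by blast
  obtain V where V: "primitive V h" "AE t in lebesgue. v t = V t"
    using has_weak_deriv_imp_primitive[OF v] by blast
  have li: "locally_integrable (\<lambda>t. u t + c * v t)" "locally_integrable (\<lambda>t. g t + c * h t)"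
    using u v by (auto simp: has_weak_deriv_def intro!: locally_integrable_add locally_integrable_mult)
  show ?thesis
  proof (rule has_weak_deriv_cong_AE)
    show "has_weak_deriv (\<lambda>t. U t + c * V t) (\<lambda>t. g t + c * h t)"
      by (intro primitive_has_weak_deriv primitive_add primitive_mult U V)
    show "AE t in lebesgue. U t + c * V t = u t + c * v t"
      using U(2) V(2) by eventually_elim simp
  qed (use li in \<open>auto intro: locally_integrable_measurable\<close>)
qed

lemma L2_cong_AE:
  assumes "u \<in> L2" "AE t in lebesgue. u t = v t" "v \<in> borel_measurable lebesgue"
  shows "v \<in> L2"
proof (rule L2_bound[OF L2_square_integrable[OF assms(1)] assms(3)])
  show "AE t in lebesgue. (v t)\<^sup>2 \<le> (u t)\<^sup>2"
    using assms(2) by eventually_elim simp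
qed

text \<open>The square integrable derivative in the definition of \<open>H1\<close> and the one
  chosen by \<open>weak_deriv\<close> agree almost everywhere, so square integrability passes to the
  chosen one.\<close>

lemma H1_weak_deriv:
  assumes "u \<in> H1"
  shows "u \<in> L2" "weak_deriv u \<in> L2" "has_weak_deriv u (weak_deriv u)"
proof -
  obtain g where g: "u \<in> L2" "g \<in> L2" "has_weak_deriv u g"
    using assms by (auto simp: H1_def)
  show w: "has_weak_deriv u (weak_deriv u)"
    using has_weak_deriv_weak_deriv[OF g(3)] .
  have "AE t in lebesgue. g t = weak_deriv u t"
    by (rule has_weak_deriv_unique[OF g(3) w]) simp
  moreover have "weak_deriv u \<in> borel_measurable lebesgue"
    using w by (intro locally_integrable_measurable) (simp add: has_weak_deriv_def)
  ultimately show "weak_deriv u \<in> L2"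
    using L2_cong_AE[OF g(2)] by blast
  show "u \<in> L2" by (rule g)
qed

lemma H1I:
  assumes "u \<in> L2" "g \<in> L2" "has_weak_deriv u g"
  shows "u \<in> H1" "AE t in lebesgue. weak_deriv u t = g t"
proof -
  show "u \<in> H1" using assms by (auto simp: H1_def)
  show "AE t in lebesgue. weak_deriv u t = g t"
    by (rule has_weak_deriv_unique[OF has_weak_deriv_weak_deriv[OF assms(3)] assms(3)]) simp
qed

lemma L2_subset_L2_loc: "u \<in> L2 \<Longrightarrow> u \<in> L2_loc"
  using integrable_mult_indicator[of "{-R..R}" lebesgue "\<lambda>t. (u t)\<^sup>2" for R]
  by (auto simp: L2_def L2_loc_def set_integrable_def)

lemma H1_subset_H1_loc: "u \<in> H1 \<Longrightarrow> u \<in> H1_loc"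
  using L2_subset_L2_loc by (auto simp: H1_def H1_loc_def)

lemma test_function_L2:
  assumes "\<phi> \<in> test_functions" shows "\<phi> \<in> L2" "deriv \<phi> \<in> L2"
proof -
  note c = test_function_DERIV(2,3)[OF assms]
  have "integrable lebesgue (\<lambda>t. \<phi> t * \<phi> t)" "integrable lebesgue (\<lambda>t. deriv \<phi> t * deriv \<phi> t)"
    using integrable_mult_test_function[OF continuous_locally_integrable assms] c by blast+
  then show "\<phi> \<in> L2" "deriv \<phi> \<in> L2"
    using c by (auto simp: L2_def power2_eq_square intro: continuous_lebesgue_measurable)
qed

lemma test_function_bounded:
  assumes "\<phi> \<in> test_functions" shows "\<exists>B\<ge>0. \<forall>t. \<bar>\<phi> t\<bar> \<le> B"
proof -
  obtain R where R: "\<And>t. t \<notin> {-R<..<R} \<Longrightarrow> \<phi> t = 0"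
    using test_function_support[OF assms] by blast
  obtain B where B: "\<And>t. t \<in> {-R..R} \<Longrightarrow> \<bar>\<phi> t\<bar> \<le> B"
    using continuous_bounded_Icc[OF test_function_DERIV(2)[OF assms], of "-R" R] by blast
  have "\<bar>\<phi> t\<bar> \<le> max B 0" for t
  proof (cases "t \<in> {-R<..<R}")
    case True then show ?thesis using B[of t] by auto
  next
    case False then show ?thesis using R[of t] by simp
  qed
  then show ?thesis by (intro exI[of _ "max B 0"]) auto
qed

text \<open>The set where the bound fails is open and null, hence empty.\<close>

lemma continuous_AE_bound:
  fixes U :: "real \<Rightarrow> real"
  assumes U: "continuous_on UNIV U" and le: "AE t in lebesgue. \<bar>U t\<bar> \<le> r"
  shows "\<bar>U t\<bar> \<le> r"
proof -
  have op: "open {t. \<bar>U t\<bar> > r}"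
    by (intro open_Collect_less continuous_intros U)
  have "{t. \<bar>U t\<bar> > r} \<in> null_sets lebesgue"
  proof (subst AE_iff_null_sets)
    show "{t. \<bar>U t\<bar> > r} \<in> sets lebesgue"
      using op by (simp add: borel_open)
    show "AE t in lebesgue. t \<notin> {t. \<bar>U t\<bar> > r}"
      using le by eventually_elim simp
  qed
  then have "negligible {t. \<bar>U t\<bar> > r}" by (simp add: negligible_iff_null_sets)
  then have "{t. \<bar>U t\<bar> > r} = {}" using open_not_negligible[OF op] by blast
  then show ?thesis by (metis (mono_tags) empty_Collect_eq not_less)
qed

section \<open>Elementary inequalities for hyperbolic and trigonometric functions\<close>

lemma cosh_real_le:
  assumes "\<bar>x\<bar> \<le> y" shows "cosh (x::real) \<le> cosh y"
proof -
  have "cosh \<bar>x\<bar> \<le> cosh y"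
    using assms by (subst cosh_real_nonneg_le_iff) auto
  then show ?thesis by (simp add: abs_if split: if_splits)
qed

lemma DERIV_sinh: "(sinh has_real_derivative cosh (x::real)) (at x)"
  by (auto intro!: derivative_eq_intros)

text \<open>The mean value theorem gives a bound linear in x, through which sinh (2 a) inherits
  square integrability from a bounded a.\<close>

lemma abs_sinh_real_le:
  assumes "\<bar>x\<bar> \<le> y" shows "\<bar>sinh (x::real)\<bar> \<le> \<bar>x\<bar> * cosh y"
proof -
  have *: "\<bar>sinh z\<bar> \<le> z * cosh y" if "0 \<le> z" "z \<le> y" for z :: real
  proof (cases "z = 0")
    case False
    then have "0 < z" using that by simp
    then obtain w where "0 < w" "w < z" "sinh z - sinh 0 = (z - 0) * cosh w"
      using MVT2[OF \<open>0 < z\<close> DERIV_sinh] by blast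
    then show ?thesis
      using that cosh_real_le[of w y] by (simp add: abs_mult mult_left_mono cosh_real_pos less_imp_le)
  qed simp
  from *[of "\<bar>x\<bar>"] assms show ?thesis by (simp add: abs_if split: if_splits)
qed

text \<open>A weak form of Jordan's inequality, and the place where the bound pi/2 is used for
  coercivity. With y = z/2 one has sin z = 2 sin y cos y \<ge> 2 y (cos y)^2 = y (1 + cos z) \<ge>
  y.\<close>

lemma half_abs_le_abs_sin:
  assumes "\<bar>x\<bar> \<le> pi / 2" shows "\<bar>x\<bar> / 2 \<le> \<bar>sin x\<bar>"
proof -
  have *: "z / 2 \<le> sin z" if "0 \<le> z" "z \<le> pi / 2" for z
  proof (cases "z = 0")
    case False
    define y where "y = z / 2"
    have y: "0 < y" "y \<le> pi / 4" using False that by (auto simp: y_def)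
    obtain w where w: "0 < w" "w < y" "sin y - sin 0 = (y - 0) * cos w"
      using MVT2[OF y(1) DERIV_sin] by blast
    have "cos y \<le> cos w" using w y by (intro cos_monotone_0_pi_le) auto
    then have "y * cos y \<le> sin y" using w y by (simp add: mult_left_mono)
    moreover have "cos y \<ge> 0" using y by (intro cos_ge_zero) auto
    ultimately have "2 * (y * cos y) * cos y \<le> 2 * sin y * cos y"
      by (intro mult_right_mono mult_left_mono) auto
    also have "\<dots> = sin z" by (simp add: y_def sin_double[symmetric])
    finally have "y * (2 * (cos y)\<^sup>2) \<le> sin z" by (simp add: power2_eq_square algebra_simps)
    moreover have "2 * (cos y)\<^sup>2 = 1 + cos z" by (simp add: y_def cos_double_cos[of "z / 2", simplified])
    moreover have "cos z \<ge> 0" using that by (intro cos_ge_zero) auto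
    ultimately have "y * (1 + cos z) \<le> sin z" "y * 1 \<le> y * (1 + cos z)"
      using y by (auto intro: mult_left_mono)
    then show ?thesis by (simp add: y_def)
  qed simp
  from *[of "\<bar>x\<bar>"] assms show ?thesis by (simp add: abs_if split: if_splits)
qed

text \<open>By the addition theorems each remainder combines cos h - 1 and sin h - h, both at most
  h^2/2 in absolute value, with coefficients of absolute value at most 1.\<close>

lemma sin_cos_second_order:
  fixes x h :: real
  shows "\<bar>cos (x + h) - cos x + h * sin x\<bar> \<le> h\<^sup>2" "\<bar>sin (x + h) - sin x - h * cos x\<bar> \<le> h\<^sup>2"
proof -
  have s: "\<bar>sin h - h\<bar> \<le> h\<^sup>2 / 2"
    using Maclaurin_sin_bound[of h 2] by (simp add: sin_coeff_def numeral_2_eq_2)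
  have c: "\<bar>cos h - 1\<bar> \<le> h\<^sup>2 / 2"
  proof -
    have "1 - cos h = 2 * (sin (h / 2))\<^sup>2"
      using cos_double_sin[of "h / 2"] by simp
    moreover have "(sin (h / 2))\<^sup>2 \<le> (h / 2)\<^sup>2"
      using abs_sin_x_le_abs_x[of "h / 2"] by (simp only: abs_le_square_iff)
    ultimately show ?thesis by (simp add: power_divide)
  qed
  have mix: "\<bar>u * p + v * q\<bar> \<le> h\<^sup>2" if "\<bar>u\<bar> \<le> 1" "\<bar>v\<bar> \<le> 1" "\<bar>p\<bar> \<le> h\<^sup>2 / 2" "\<bar>q\<bar> \<le> h\<^sup>2 / 2" for u v p q :: real
  proof -
    have "\<bar>u * p + v * q\<bar> \<le> \<bar>u\<bar> * \<bar>p\<bar> + \<bar>v\<bar> * \<bar>q\<bar>"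
      by (metis abs_mult abs_triangle_ineq)
    also have "\<dots> \<le> 1 * (h\<^sup>2 / 2) + 1 * (h\<^sup>2 / 2)"
      using that by (intro add_mono mult_mono) auto
    finally show ?thesis by simp
  qed
  have "cos (x + h) - cos x + h * sin x = cos x * (cos h - 1) + (- sin x) * (sin h - h)"
    by (simp add: cos_add algebra_simps)
  with mix[of "cos x" "- sin x"] s c show "\<bar>cos (x + h) - cos x + h * sin x\<bar> \<le> h\<^sup>2"
    by simp
  have "sin (x + h) - sin x - h * cos x = sin x * (cos h - 1) + cos x * (sin h - h)"
    by (simp add: sin_add algebra_simps)
  with mix[of "sin x" "cos x"] s c show "\<bar>sin (x + h) - sin x - h * cos x\<bar> \<le> h\<^sup>2"
    by simp
qed

text \<open>For \<epsilon> of the sign opposite to p and small enough, the quadratic term is at most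
  half of the linear one and cannot compensate it.\<close>

lemma quadratic_perturbation_zero:
  fixes p q \<epsilon>\<^sub>0 :: real
  assumes "\<epsilon>\<^sub>0 > 0" and nn: "\<And>\<epsilon>. \<bar>\<epsilon>\<bar> \<le> \<epsilon>\<^sub>0 \<Longrightarrow> 0 \<le> \<epsilon> * p + \<epsilon>\<^sup>2 * q"
  shows "p = 0"
proof (rule ccontr)
  assume "p \<noteq> 0"
  define \<epsilon> where "\<epsilon> = min \<epsilon>\<^sub>0 (\<bar>p\<bar> / (2 * (\<bar>q\<bar> + 1)))"
  have e: "0 < \<epsilon>" "\<epsilon> \<le> \<epsilon>\<^sub>0" "\<epsilon> * (\<bar>q\<bar> + 1) \<le> \<bar>p\<bar> / 2"
  proof -
    have "\<epsilon> \<le> \<bar>p\<bar> / (2 * (\<bar>q\<bar> + 1))" by (simp add: \<epsilon>_def)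
    then show "\<epsilon> * (\<bar>q\<bar> + 1) \<le> \<bar>p\<bar> / 2" by (simp add: field_simps)
  qed (use \<open>p \<noteq> 0\<close> \<open>\<epsilon>\<^sub>0 > 0\<close> in \<open>auto simp: \<epsilon>_def\<close>)
  have "\<epsilon> * \<bar>p\<bar> \<le> \<epsilon>\<^sup>2 * q"
    using nn[of "- sgn p * \<epsilon>"] e \<open>p \<noteq> 0\<close>
    by (cases "p > 0") (auto simp: sgn_if abs_mult power_mult_distrib)
  also have "\<dots> \<le> \<epsilon>\<^sup>2 * (\<bar>q\<bar> + 1)" by (intro mult_left_mono) auto
  also have "\<dots> = \<epsilon> * (\<epsilon> * (\<bar>q\<bar> + 1))" by (simp add: power2_eq_square)
  also have "\<dots> \<le> \<epsilon> * (\<bar>p\<bar> / 2)" using e by (intro mult_left_mono) auto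
  finally show False using e \<open>p \<noteq> 0\<close> by simp
qed

section \<open>The phase functional\<close>

lemma Linf_norm_less:
  assumes "Linf_norm u < ereal B"
  obtains r where "r < B" "AE t in lebesgue. \<bar>u t\<bar> \<le> r"
proof -
  have ae: "AE t in lebesgue. ereal \<bar>u t\<bar> \<le> Linf_norm u"
    unfolding Linf_norm_def by (rule esssup_AE)
  show ?thesis
  proof (cases "Linf_norm u")
    case (real r)
    with that[of r] assms ae show ?thesis by simp
  next
    \<comment> \<open>As an extended real the essential supremum might formally be -infinity; any
      real number is then an upper bound almost everywhere.\<close>
    case MInf
    have "AE t in lebesgue. \<bar>u t\<bar> \<le> B - 1"
      using ae unfolding MInf by eventually_elim auto
    with that[of "B - 1"] show ?thesis by simp
  qed (use assms in simp)
qed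

locale phase_setting =
  fixes m :: real and a :: "real \<Rightarrow> real"
  assumes m_pos: "m > 0" and a_H1: "a \<in> H1" and a_Linf: "a \<in> Linf"
begin

abbreviation b :: "real \<Rightarrow> real" where "b \<equiv> weak_deriv a"

definition s :: "real \<Rightarrow> real" where "s t = sinh (2 * a t)"

definition c :: "real \<Rightarrow> real" where "c t = cosh (2 * a t)"

definition pot :: "real \<Rightarrow> real \<Rightarrow> real" where
  "pot t x = (m * c t * cos (2 * x) - b t * sin (2 * x) - m)\<^sup>2
           + (m * c t * sin (2 * x) + b t * cos (2 * x))\<^sup>2"

text \<open>The angle 2 x rotates the vector (m c, b), whose length is preserved; only the cross
  terms with m depend on x. This form is affine in the sine and cosine of 2 x, as the second-order
  expansion requires.\<close>

lemma pot_eq: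
  "pot t x = (m * c t)\<^sup>2 + (b t)\<^sup>2 + m\<^sup>2 - 2 * m\<^sup>2 * c t * cos (2 * x) + 2 * m * b t * sin (2 * x)"
proof -
  have "(p * C - q * S - m)\<^sup>2 + (p * S + q * C)\<^sup>2
      = (p\<^sup>2 + q\<^sup>2) * (S\<^sup>2 + C\<^sup>2) + m\<^sup>2 - 2 * m * p * C + 2 * m * q * S" for p q C S :: real
    by (simp add: power2_eq_square algebra_simps)
  from this[of "m * c t" "cos (2 * x)" "b t" "sin (2 * x)"] show ?thesis
    unfolding pot_def sin_cos_squared_add by (simp add: power2_eq_square[of m] algebra_simps)
qed

text \<open>The form for integrability and coercivity: the constants, not integrable on the line,
  are gathered into (c - 1)^2 and (sin x)^2.\<close>

lemma pot_eq_sin: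
  "pot t x = (m * (c t - 1))\<^sup>2 + (b t)\<^sup>2 + 4 * m\<^sup>2 * c t * (sin x)\<^sup>2 + 2 * m * b t * sin (2 * x)"
  unfolding pot_eq cos_double_sin by (simp add: power2_eq_square algebra_simps)

lemma pot_nonneg: "0 \<le> pot t x"
  by (simp add: pot_def)

lemma pot_continuous: "continuous_on UNIV (pot t)"
  unfolding pot_def by (intro continuous_intros)

lemmas a_L2 = H1_weak_deriv(1)[OF a_H1]
  and b_L2 = H1_weak_deriv(2)[OF a_H1]
  and a_weak_deriv = H1_weak_deriv(3)[OF a_H1]

lemma a_measurable [measurable]: "a \<in> borel_measurable lebesgue"
  by (rule L2_measurable[OF a_L2])

lemma b_measurable [measurable]: "b \<in> borel_measurable lebesgue"
  by (rule L2_measurable[OF b_L2])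

lemma s_measurable [measurable]: "s \<in> borel_measurable lebesgue"
proof -
  have "(sinh :: real \<Rightarrow> real) \<in> borel_measurable borel"
    by (intro borel_measurable_continuous_onI continuous_intros)
  from measurable_compose[OF _ this, of "\<lambda>t. 2 * a t"] show ?thesis
    unfolding s_def[abs_def] by simp
qed

lemma c_measurable [measurable]: "c \<in> borel_measurable lebesgue"
proof -
  have "(cosh :: real \<Rightarrow> real) \<in> borel_measurable borel"
    by (intro borel_measurable_continuous_onI continuous_intros)
  from measurable_compose[OF _ this, of "\<lambda>t. 2 * a t"] show ?thesis
    unfolding c_def[abs_def] by simp
qed

lemma pot_measurable [measurable]:
  assumes [measurable]: "d \<in> borel_measurable lebesgue"
  shows "(\<lambda>t. pot t (d t)) \<in> borel_measurable lebesgue"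
  unfolding pot_def by measurable

lemma c_ge_1: "1 \<le> c t"
  by (simp add: c_def cosh_real_ge_1)

lemma c_bounded: "\<exists>C. AE t in lebesgue. c t \<le> C \<and> \<bar>s t\<bar> \<le> C * \<bar>a t\<bar>"
proof -
  have "Linf_norm a < \<infinity>" using a_Linf by (simp add: Linf_def)
  then obtain n :: nat where "Linf_norm a < ereal (real n)"
    using less_PInf_Ex_of_nat by auto
  then obtain r where r: "AE t in lebesgue. \<bar>a t\<bar> \<le> r"
    by (rule Linf_norm_less)
  \<comment> \<open>The factor 2 comes from the argument 2 a in the linear bound for s; one constant
    then serves for both estimates.\<close>
  have "AE t in lebesgue. c t \<le> 2 * cosh (2 * r) \<and> \<bar>s t\<bar> \<le> 2 * cosh (2 * r) * \<bar>a t\<bar>"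
    using r
  proof eventually_elim
    case (elim t)
    have "c t \<le> cosh (2 * r)" unfolding c_def using elim by (intro cosh_real_le) simp
    moreover have "\<bar>s t\<bar> \<le> \<bar>2 * a t\<bar> * cosh (2 * r)"
      unfolding s_def using elim by (intro abs_sinh_real_le) simp
    moreover have "c t \<le> 2 * cosh (2 * r)"
      using calculation(1) cosh_real_pos[of "2 * r"] by linarith
    ultimately show ?case by (simp add: abs_mult mult.commute mult.left_commute)
  qed
  then show ?thesis by blast
qed

lemma s_L2: "s \<in> L2"
proof -
  obtain C where C: "AE t in lebesgue. c t \<le> C \<and> \<bar>s t\<bar> \<le> C * \<bar>a t\<bar>" using c_bounded by blast
  show ?thesis
  proof (rule L2_bound)
    show "integrable lebesgue (\<lambda>t. (C * a t)\<^sup>2)"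
      by (rule L2_square_integrable[OF L2_cmult[OF a_L2]])
    show "AE t in lebesgue. (s t)\<^sup>2 \<le> (C * a t)\<^sup>2"
      using C
    proof eventually_elim
      case (elim t)
      then have "\<bar>s t\<bar> \<le> \<bar>C * a t\<bar>"
        using mult_right_mono[OF abs_ge_self[of C] abs_ge_zero[of "a t"]] by (simp add: abs_mult)
      then show ?case by (simp only: abs_le_square_iff)
    qed
  qed measurable
qed

lemma pot_integrable:
  assumes d: "d \<in> L2"
  shows "integrable lebesgue (\<lambda>t. pot t (d t))"
proof -
  obtain C where C: "AE t in lebesgue. c t \<le> C \<and> \<bar>s t\<bar> \<le> C * \<bar>a t\<bar>" using c_bounded by blast
  have [measurable]: "d \<in> borel_measurable lebesgue" using d by (rule L2_measurable)
  \<comment> \<open>A majorant term by term from \<open>pot_eq_sin\<close>: (c - 1)^2 \<le> s^2,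
    (sin x)^2 \<le> x^2, and 2 x y \<le> x^2 + y^2 for the mixed term, which contributes the second
    b^2 and the last 4 m^2.\<close>
  let ?f = "\<lambda>t. m\<^sup>2 * (s t)\<^sup>2 + 2 * (b t)\<^sup>2 + (4 * m\<^sup>2 * C + 4 * m\<^sup>2) * (d t)\<^sup>2"
  show ?thesis
  proof (rule Bochner_Integration.integrable_bound)
    show "integrable lebesgue ?f"
      by (intro Bochner_Integration.integrable_add integrable_mult_right L2_square_integrable s_L2 b_L2 d)
    show "AE t in lebesgue. norm (pot t (d t)) \<le> norm (?f t)"
      using C
    proof eventually_elim
      case (elim t)
      have sinsq: "(sin x)\<^sup>2 \<le> x\<^sup>2" for x :: real
        using abs_sin_x_le_abs_x[of x] by (simp only: abs_le_square_iff)
      have "(c t - 1)\<^sup>2 \<le> (s t)\<^sup>2"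
      proof -
        have "(s t)\<^sup>2 = (c t - 1) * (c t + 1)"
        proof -
          have "(c t)\<^sup>2 = (s t)\<^sup>2 + 1" by (simp add: s_def c_def cosh_square_eq)
          then show ?thesis by (simp add: power2_eq_square algebra_simps)
        qed
        moreover have "(c t - 1) * (c t - 1) \<le> (c t - 1) * (c t + 1)"
          using c_ge_1[of t] by (intro mult_left_mono) auto
        ultimately show ?thesis by (simp add: power2_eq_square)
      qed
      then have 1: "(m * (c t - 1))\<^sup>2 \<le> m\<^sup>2 * (s t)\<^sup>2"
        by (simp add: power_mult_distrib mult_left_mono)
      have "c t * (sin (d t))\<^sup>2 \<le> C * (d t)\<^sup>2"
        using elim c_ge_1[of t] sinsq by (intro mult_mono) auto
      then have 2: "4 * m\<^sup>2 * c t * (sin (d t))\<^sup>2 \<le> 4 * m\<^sup>2 * C * (d t)\<^sup>2"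
        by (simp add: mult.assoc mult_left_mono)
      have "2 * (m * sin (2 * d t)) * b t \<le> (m * sin (2 * d t))\<^sup>2 + (b t)\<^sup>2"
        by (rule sum_squares_bound)
      also have "\<dots> \<le> m\<^sup>2 * (2 * d t)\<^sup>2 + (b t)\<^sup>2"
        unfolding power_mult_distrib[of m] by (intro add_right_mono mult_left_mono sinsq zero_le_power2)
      finally have 3: "2 * m * b t * sin (2 * d t) \<le> 4 * m\<^sup>2 * (d t)\<^sup>2 + (b t)\<^sup>2"
        by (simp add: power_mult_distrib algebra_simps)
      have "pot t (d t) \<le> ?f t"
        unfolding pot_eq_sin using add_mono[OF 1 add_mono[OF 2 3]] by (simp add: algebra_simps)
      then show ?case using pot_nonneg[of t "d t"] by simp
    qed
  qed measurable
qed

text \<open>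
  Half the energy, with the derivative as a separate argument, so that both arguments may be
  replaced by almost everywhere equal functions.
\<close>

definition J :: "(real \<Rightarrow> real) \<Rightarrow> (real \<Rightarrow> real) \<Rightarrow> real" where
  "J g d = (LINT t|lebesgue. (g t + m * s t)\<^sup>2) + (LINT t|lebesgue. pot t (d t))"

lemma kinetic_L2: "g \<in> L2 \<Longrightarrow> (\<lambda>t. g t + m * s t) \<in> L2"
  by (intro L2_add L2_cmult s_L2)

lemma J_nonneg: "0 \<le> J g d"
  unfolding J_def by (intro add_nonneg_nonneg Bochner_Integration.integral_nonneg) (auto simp: pot_nonneg)

lemma J_cong:
  assumes L: "g \<in> L2" "g' \<in> L2" "d \<in> L2" "d' \<in> L2"
    and ae: "AE t in lebesgue. g t = g' t" "AE t in lebesgue. d t = d' t"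
  shows "J g d = J g' d'"
proof -
  note [measurable] = L[THEN L2_measurable]
  have "(LINT t|lebesgue. (g t + m * s t)\<^sup>2) = (LINT t|lebesgue. (g' t + m * s t)\<^sup>2)"
  proof (rule integral_cong_AE)
    show "AE t in lebesgue. (g t + m * s t)\<^sup>2 = (g' t + m * s t)\<^sup>2"
      using ae(1) by eventually_elim simp
  qed measurable
  moreover have "(LINT t|lebesgue. pot t (d t)) = (LINT t|lebesgue. pot t (d' t))"
  proof (rule integral_cong_AE)
    show "AE t in lebesgue. pot t (d t) = pot t (d' t)"
      using ae(2) by eventually_elim simp
  qed measurable
  ultimately show ?thesis by (simp add: J_def)
qed

lemma phase_energy_eq_J:
  assumes "\<delta> \<in> H1"
  shows "phase_energy m a \<delta> = ennreal (2 * J (weak_deriv \<delta>) \<delta>)"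
proof -
  note H = H1_weak_deriv[OF assms]
  let ?e = "\<lambda>t. (weak_deriv \<delta> t + m * s t)\<^sup>2 + pot t (\<delta> t)"
  have "(\<integral>\<^sup>+ t. ennreal (?e t) \<partial>lebesgue) = ennreal (LINT t|lebesgue. ?e t)"
    using L2_square_integrable[OF kinetic_L2[OF H(2)]] pot_integrable[OF H(1)] pot_nonneg
    by (intro nn_integral_eq_integral) auto
  also have "(LINT t|lebesgue. ?e t) = J (weak_deriv \<delta>) \<delta>"
    unfolding J_def
    by (rule Bochner_Integration.integral_add[OF L2_square_integrable[OF kinetic_L2[OF H(2)]] pot_integrable[OF H(1)]])
  finally have "2 * (\<integral>\<^sup>+ t. ennreal (?e t) \<partial>lebesgue) = ennreal (2 * J (weak_deriv \<delta>) \<delta>)"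
    by (simp add: ennreal_mult J_nonneg)
  then show ?thesis
    by (simp add: phase_energy_def pot_def s_def c_def add.assoc)
qed

lemma zero_in_phase_class: "(\<lambda>_. 0) \<in> phase_class" "AE t in lebesgue. weak_deriv (\<lambda>_. 0) t = 0"
proof -
  have "primitive (\<lambda>_. 0) (\<lambda>_. 0)"
    by (auto simp: primitive_def intro: continuous_locally_integrable)
  then have w: "has_weak_deriv (\<lambda>_. 0) (\<lambda>_. 0)" by (rule primitive_has_weak_deriv)
  have z: "(\<lambda>_. 0) \<in> L2" by (simp add: L2_def)
  show "(\<lambda>_. 0) \<in> phase_class" "AE t in lebesgue. weak_deriv (\<lambda>_. 0) t = 0"
    using H1I[OF z z w] by (auto simp: phase_class_def)
qed

lemma is_arg_min_iff:
  "is_arg_min (phase_energy m a) (\<lambda>\<delta>. \<delta> \<in> phase_class) \<delta> \<longleftrightarrow>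
     \<delta> \<in> phase_class \<and> (\<forall>\<eta>\<in>phase_class. J (weak_deriv \<delta>) \<delta> \<le> J (weak_deriv \<eta>) \<eta>)"
proof -
  have "phase_energy m a \<eta> < phase_energy m a \<delta> \<longleftrightarrow> J (weak_deriv \<eta>) \<eta> < J (weak_deriv \<delta>) \<delta>"
    if "\<eta> \<in> phase_class" "\<delta> \<in> phase_class" for \<eta>
    using that J_nonneg by (simp add: phase_class_def phase_energy_eq_J ennreal_less_iff)
  then show ?thesis
    by (simp add: is_arg_min_def not_less[symmetric]) blast
qed

text \<open>Coercivity. Half of 4 m^2 (sin x)^2 absorbs the mixed term 4 m b sin x cos x at the
  price of 2 b^2, one b^2 of which is already in \<open>pot\<close>. The other half dominates m^2
  x^2 / 2 by \<open>half_abs_le_abs_sin\<close>.\<close>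

lemma square_le_pot:
  assumes "\<bar>x\<bar> \<le> pi / 2"
  shows "m\<^sup>2 * x\<^sup>2 \<le> 2 * (pot t x + (b t)\<^sup>2)"
proof -
  have 1: "m\<^sup>2 * (sin x)\<^sup>2 \<le> m\<^sup>2 * c t * (sin x)\<^sup>2"
    using mult_right_mono[OF c_ge_1[of t], of "m\<^sup>2 * (sin x)\<^sup>2"] by (simp add: mult_ac)
  have "- (2 * (m * sin x) * (b t * cos x)) \<le> (m * sin x)\<^sup>2 + (b t * cos x)\<^sup>2"
    using zero_le_power2[of "m * sin x + b t * cos x"] by (simp add: power2_eq_square algebra_simps)
  moreover have "(b t * cos x)\<^sup>2 \<le> (b t)\<^sup>2"
    using mult_left_mono[OF abs_square_le_1[THEN iffD2, OF abs_cos_le_one[of x]] zero_le_power2[of "b t"]]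
    by (simp add: power_mult_distrib)
  ultimately have 2: "- (2 * m * b t * sin (2 * x)) \<le> 2 * m\<^sup>2 * (sin x)\<^sup>2 + 2 * (b t)\<^sup>2"
    unfolding sin_double by (simp add: power_mult_distrib algebra_simps)
  have 3: "0 \<le> (m * (c t - 1))\<^sup>2" by simp
  have sin2: "2 * (m\<^sup>2 * (sin x)\<^sup>2) \<le> pot t x + (b t)\<^sup>2"
    unfolding pot_eq_sin using 1 2 3 by linarith
  have "(x / 2)\<^sup>2 \<le> (sin x)\<^sup>2"
    using half_abs_le_abs_sin[OF assms] abs_le_square_iff[of "x / 2" "sin x"] by simp
  then have "m\<^sup>2 * (x / 2)\<^sup>2 \<le> m\<^sup>2 * (sin x)\<^sup>2" by (intro mult_left_mono) auto
  with sin2 show ?thesis by (simp add: power_divide)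
qed

end

section \<open>Existence of minimizers\<close>

text \<open>The Arzela-Ascoli argument: a diagonal sequence converges at all rationals, and the
  Hoelder bound, uniform in n, carries the Cauchy property to every real point.\<close>

lemma Hoelder_pointwise_convergent_subsequence:
  fixes D :: "nat \<Rightarrow> real \<Rightarrow> real"
  assumes bound: "\<And>n t. \<bar>D n t\<bar> \<le> M"
    and Hoelder: "\<And>n x y. x \<le> y \<Longrightarrow> (D n y - D n x)\<^sup>2 \<le> (y - x) * B"
  obtains k :: "nat \<Rightarrow> nat" where "strict_mono k" "\<And>t. convergent (\<lambda>n. D (k n) t)"
proof -
  obtain k :: "nat \<Rightarrow> nat" where k: "strict_mono k" "\<And>q. q \<in> \<rat> \<Longrightarrow> \<exists>l. (\<lambda>n. D (k n) q) \<longlonglongrightarrow> l"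
    using function_convergent_subsequence[of "\<rat> :: real set" D M] bound countable_rat by auto
  have "convergent (\<lambda>n. D (k n) t)" for t
  proof (rule Cauchy_convergent, rule CauchyI)
    fix e :: real assume "e > 0"
    \<comment> \<open>Chosen so that \<eta> (|B| + 1) = (e/3)^2; a rational point within \<eta> of t
      then changes each D n by less than e/3.\<close>
    define \<eta> where "\<eta> = (e / 3)\<^sup>2 / (\<bar>B\<bar> + 1)"
    have "\<eta> > 0" using \<open>e > 0\<close> by (simp add: \<eta>_def add_nonneg_pos)
    obtain q where q: "q \<in> \<rat>" "t < q" "q < t + \<eta>"
      using Rats_dense_in_real[of t "t + \<eta>"] \<open>\<eta> > 0\<close> by auto
    have near: "\<bar>D n q - D n t\<bar> < e / 3" for n
    proof -
      have "(D n q - D n t)\<^sup>2 \<le> (q - t) * B" using Hoelder[of t q n] q by simp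
      also have "\<dots> \<le> (q - t) * (\<bar>B\<bar> + 1)" using q by (intro mult_left_mono) auto
      also have "\<dots> < \<eta> * (\<bar>B\<bar> + 1)" using q by (intro mult_strict_right_mono) auto
      also have "\<dots> = (e / 3)\<^sup>2" by (simp add: \<eta>_def)
      finally have "\<bar>D n q - D n t\<bar>\<^sup>2 < (e / 3)\<^sup>2" by simp
      then show ?thesis by (rule power2_less_imp_less) (use \<open>e > 0\<close> in simp)
    qed
    have "Cauchy (\<lambda>n. D (k n) q)"
      using k(2)[OF q(1)] by (auto intro: convergent_Cauchy convergentI)
    then obtain N where N: "\<And>i j. i \<ge> N \<Longrightarrow> j \<ge> N \<Longrightarrow> norm (D (k i) q - D (k j) q) < e / 3"
      using CauchyD[of _ "e / 3"] \<open>e > 0\<close> by (metis divide_pos_pos zero_less_numeral)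
    have "norm (D (k i) t - D (k j) t) < e" if "i \<ge> N" "j \<ge> N" for i j
      using N[OF that] near[of "k i"] near[of "k j"] unfolding real_norm_def by linarith
    then show "\<exists>N. \<forall>i\<ge>N. \<forall>j\<ge>N. norm (D (k i) t - D (k j) t) < e" by blast
  qed
  with k(1) that show ?thesis by blast
qed

context phase_setting
begin

text \<open>The continuous representative satisfies the constraint at every point, which the
  pointwise compactness argument relies on, and has the same energy.\<close>

lemma phase_class_representative:
  assumes "\<delta> \<in> phase_class"
  obtains D where "primitive D (weak_deriv \<delta>)" "D \<in> L2" "\<And>t. \<bar>D t\<bar> \<le> pi / 2"
    "J (weak_deriv \<delta>) D = J (weak_deriv \<delta>) \<delta>"
proof -
  have H: "\<delta> \<in> H1" and le: "AE t in lebesgue. \<bar>\<delta> t\<bar> \<le> pi / 2"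
    using assms by (auto simp: phase_class_def)
  note w = H1_weak_deriv[OF H]
  obtain D where D: "primitive D (weak_deriv \<delta>)" and ae: "AE t in lebesgue. \<delta> t = D t"
    using has_weak_deriv_imp_primitive[OF w(3)] by blast
  have cont: "continuous_on UNIV D" by (rule primitive_continuous[OF D])
  have L: "D \<in> L2" by (rule L2_cong_AE[OF w(1) ae continuous_lebesgue_measurable[OF cont]])
  have "AE t in lebesgue. \<bar>D t\<bar> \<le> pi / 2"
    using le ae by eventually_elim simp
  then have "\<And>t. \<bar>D t\<bar> \<le> pi / 2" by (rule continuous_AE_bound[OF cont])
  moreover have "J (weak_deriv \<delta>) D = J (weak_deriv \<delta>) \<delta>"
    by (rule J_cong[OF w(2) w(2) L w(1)]) (use ae in auto)
  ultimately show ?thesis using that[OF D L] by blast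
qed

lemma minimizing_sequence_limit:
  fixes D g :: "nat \<Rightarrow> real \<Rightarrow> real"
  assumes prim: "\<And>n. primitive (D n) (g n)" and DL: "\<And>n. D n \<in> L2" and gL: "\<And>n. g n \<in> L2"
    and bound: "\<And>n t. \<bar>D n t\<bar> \<le> pi / 2" and J_lim: "(\<lambda>n. J (g n) (D n)) \<longlonglongrightarrow> I"
  shows "\<exists>\<delta>\<in>phase_class. J (weak_deriv \<delta>) \<delta> \<le> I"
proof -
  define K where "K n = (LINT t|lebesgue. (g n t + m * s t)\<^sup>2)" for n
  define P where "P n = (LINT t|lebesgue. pot t (D n t))" for n
  have J: "J (g n) (D n) = K n + P n" for n by (simp add: J_def K_def P_def)
  have K_nn: "0 \<le> K n" and P_nn: "0 \<le> P n" for n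
    unfolding K_def P_def by (auto intro!: Bochner_Integration.integral_nonneg simp: pot_nonneg)
  obtain C where C: "\<And>n. J (g n) (D n) \<le> C"
    using convergent_imp_Bseq[OF convergentI[OF J_lim]] by (auto simp: Bseq_def abs_le_iff)
  have K_le: "K n \<le> C" for n using C[of n] P_nn[of n] J[of n] by simp
  \<comment> \<open>From x^2 \<le> 2 (x + y)^2 + 2 y^2 with y = m s, which removes the shift from
    the kinetic term.\<close>
  define B where "B = 2 * C + 2 * (LINT t|lebesgue. (m * s t)\<^sup>2)"
  have g_le: "(LINT t|lebesgue. (g n t)\<^sup>2) \<le> B" for n
  proof -
    note i = L2_square_integrable[OF kinetic_L2[OF gL[of n]]] L2_square_integrable[OF L2_cmult[OF s_L2, of m]]
    have "x\<^sup>2 \<le> 2 * (x + y)\<^sup>2 + 2 * y\<^sup>2" for x y :: real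
      using zero_le_power2[of "x + 2 * y"] by (simp add: power2_eq_square algebra_simps)
    then have "(LINT t|lebesgue. (g n t)\<^sup>2) \<le> (LINT t|lebesgue. 2 * (g n t + m * s t)\<^sup>2 + 2 * (m * s t)\<^sup>2)"
      using i by (intro integral_mono L2_square_integrable gL) auto
    also have "\<dots> = 2 * K n + 2 * (LINT t|lebesgue. (m * s t)\<^sup>2)"
      using i by (simp add: K_def del: power_mult_distrib)
    also have "\<dots> \<le> B" using K_le[of n] by (simp add: B_def)
    finally show ?thesis .
  qed
  have "(D n y - D n x)\<^sup>2 \<le> (y - x) * B" if "x \<le> y" for n x y
  proof -
    have "(D n y - D n x)\<^sup>2 \<le> (y - x) * (LINT t|lebesgue. (g n t)\<^sup>2)"
      unfolding primitive_increment[OF prim that] by (rule interval_integral_square_le[OF gL that])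
    also have "\<dots> \<le> (y - x) * B" using g_le that by (intro mult_left_mono) auto
    finally show ?thesis .
  qed
  then obtain k1 where k1: "strict_mono k1" "\<And>t. convergent (\<lambda>n. D (k1 n) t)"
    using Hoelder_pointwise_convergent_subsequence[of D "pi / 2" B, OF bound] by blast
  \<comment> \<open>A second subsequence makes the kinetic terms converge; the potential terms then
    converge to the remainder I - \<alpha>, and the two lower semicontinuity bounds add up to
    I.\<close>
  have "bounded (range (\<lambda>n. K (k1 n)))"
    using K_nn K_le by (intro boundedI[of _ C]) auto
  then obtain \<alpha> k2 where k2: "strict_mono k2" "((\<lambda>n. K (k1 n)) \<circ> k2) \<longlonglongrightarrow> \<alpha>"
    using bounded_imp_convergent_subsequence by blast
  define k where "k = k1 \<circ> k2"
  have k: "strict_mono k" unfolding k_def using k1(1) k2(1) by (rule strict_mono_o)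
  have K_lim: "(\<lambda>n. K (k n)) \<longlonglongrightarrow> \<alpha>" using k2(2) by (simp add: k_def o_def)
  have P_lim: "(\<lambda>n. P (k n)) \<longlonglongrightarrow> I - \<alpha>"
    using tendsto_diff[OF LIMSEQ_subseq_LIMSEQ[OF J_lim k] K_lim] by (simp add: o_def J)
  define d where "d t = lim (\<lambda>n. D (k n) t)" for t
  have d_lim: "(\<lambda>n. D (k n) t) \<longlonglongrightarrow> d t" for t
    using convergent_subseq_convergent[OF k1(2) k2(1)]
    by (simp add: d_def k_def o_def convergent_LIMSEQ_iff)
  have d_bound: "\<bar>d t\<bar> \<le> pi / 2" for t
    by (rule LIMSEQ_le_const2[OF tendsto_rabs[OF d_lim]]) (use bound in auto)

  \<comment> \<open>The kinetic integrand is the square of the derivative of D + m S, so the weak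
    limit is taken for these functions and m S is subtracted afterwards.\<close>
  obtain S where S: "primitive S s" using primitive_exists[OF L2_locally_integrable[OF s_L2]] by blast
  define \<Phi> where "\<Phi> t = d t + m * S t" for t
  have "\<exists>f\<in>L2. primitive \<Phi> f \<and> (LINT t|lebesgue. (f t)\<^sup>2) \<le> \<alpha>"
  proof (rule primitive_weak_limit)
    show "(\<lambda>t. g (k n) t + m * s t) \<in> L2" for n by (rule kinetic_L2[OF gL])
    show "(\<lambda>n. LINT t|lebesgue. (g (k n) t + m * s t)\<^sup>2) \<longlonglongrightarrow> \<alpha>"
      using K_lim by (simp add: K_def)
    fix x y :: real assume "x \<le> y"
    have "(LINT t:{x..y}|lebesgue. g (k n) t + m * s t) = D (k n) y + m * S y - (D (k n) x + m * S x)" for n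
      by (rule primitive_increment[OF primitive_add[OF prim primitive_mult[OF S]] \<open>x \<le> y\<close>, symmetric])
    then show "(\<lambda>n. LINT t:{x..y}|lebesgue. g (k n) t + m * s t) \<longlonglongrightarrow> \<Phi> y - \<Phi> x"
      unfolding \<Phi>_def by (auto intro!: tendsto_intros d_lim)
  qed
  then obtain f where f: "f \<in> L2" "primitive \<Phi> f" "(LINT t|lebesgue. (f t)\<^sup>2) \<le> \<alpha>" by blast
  define \<gamma> where "\<gamma> t = f t + (- m) * s t" for t
  have "primitive (\<lambda>t. \<Phi> t + (- m) * S t) \<gamma>"
    unfolding \<gamma>_def by (intro primitive_add primitive_mult f S)
  then have d_prim: "primitive d \<gamma>" by (simp add: \<Phi>_def)
  have \<gamma>: "\<gamma> \<in> L2" unfolding \<gamma>_def by (intro L2_add L2_cmult f s_L2)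
  have [measurable]: "d \<in> borel_measurable lebesgue"
    by (rule continuous_lebesgue_measurable[OF primitive_continuous[OF d_prim]])
  have pot_d: "integrable lebesgue (\<lambda>t. pot t (d t)) \<and> (LINT t|lebesgue. pot t (d t)) \<le> I - \<alpha>"
  proof (rule Fatou_nonneg)
    show "integrable lebesgue (\<lambda>t. pot t (D (k n) t))" for n by (rule pot_integrable[OF DL])
    show "AE t in lebesgue. (\<lambda>n. pot t (D (k n) t)) \<longlonglongrightarrow> pot t (d t)"
      using continuous_on_tendsto_compose[OF pot_continuous d_lim] by auto
    show "(\<lambda>n. P (k n)) \<longlonglongrightarrow> I - \<alpha>" by (rule P_lim)
  qed (auto simp: pot_nonneg P_def)
  \<comment> \<open>Pointwise convergence does not place d in L2; the finite potential of the limit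
    does, by coercivity.\<close>
  have "(\<lambda>t. m * d t) \<in> L2"
  proof (rule L2_bound)
    show "integrable lebesgue (\<lambda>t. 2 * (pot t (d t) + (b t)\<^sup>2))"
      using pot_d L2_square_integrable[OF b_L2] by simp
    show "AE t in lebesgue. (m * d t)\<^sup>2 \<le> 2 * (pot t (d t) + (b t)\<^sup>2)"
      using square_le_pot[OF d_bound] by (simp add: power_mult_distrib)
  qed measurable
  from L2_cmult[OF this, of "1 / m"] have dL: "d \<in> L2" using m_pos by simp
  note H = H1I[OF dL \<gamma> primitive_has_weak_deriv[OF d_prim]]
  have "d \<in> phase_class" using H(1) d_bound by (simp add: phase_class_def)
  moreover have "J (weak_deriv d) d = J \<gamma> d"
    by (rule J_cong[OF H1_weak_deriv(2)[OF H(1)] \<gamma> dL dL H(2)]) simp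
  moreover have "J \<gamma> d \<le> \<alpha> + (I - \<alpha>)"
    unfolding J_def using f(3) pot_d by (intro add_mono) (auto simp: \<gamma>_def)
  ultimately show ?thesis by (intro bexI[of _ d]) auto
qed

lemma minimizer_exists: "\<exists>\<delta>. is_arg_min (phase_energy m a) (\<lambda>\<delta>. \<delta> \<in> phase_class) \<delta>"
proof -
  define E where "E \<delta> = J (weak_deriv \<delta>) \<delta>" for \<delta>
  define I where "I = Inf (E ` phase_class)"
  have bdd: "bdd_below (E ` phase_class)"
    by (rule bdd_belowI[of _ 0]) (auto simp: E_def J_nonneg)
  have ne: "E ` phase_class \<noteq> {}" using zero_in_phase_class(1) by blast
  have I_le: "I \<le> E \<delta>" if "\<delta> \<in> phase_class" for \<delta>
    unfolding I_def using that bdd by (auto intro: cInf_lower)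
  have "\<exists>\<delta>\<in>phase_class. E \<delta> < I + inverse (real (Suc n))" for n
    using cInf_lessD[OF ne, of "I + inverse (real (Suc n))"] by (auto simp: I_def)
  then obtain \<delta> where \<delta>: "\<And>n. \<delta> n \<in> phase_class" "\<And>n. E (\<delta> n) < I + inverse (real (Suc n))"
    by metis
  have "\<exists>D. primitive D (weak_deriv (\<delta> n)) \<and> D \<in> L2 \<and> (\<forall>t. \<bar>D t\<bar> \<le> pi / 2) \<and>
      J (weak_deriv (\<delta> n)) D = E (\<delta> n)" for n
    using phase_class_representative[OF \<delta>(1)[of n]] unfolding E_def by metis
  then obtain D where D: "\<And>n. primitive (D n) (weak_deriv (\<delta> n))" "\<And>n. D n \<in> L2"
    "\<And>n t. \<bar>D n t\<bar> \<le> pi / 2" "\<And>n. J (weak_deriv (\<delta> n)) (D n) = E (\<delta> n)"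
    by metis
  have "\<exists>\<delta>\<in>phase_class. J (weak_deriv \<delta>) \<delta> \<le> I"
  proof (rule minimizing_sequence_limit[of D "\<lambda>n. weak_deriv (\<delta> n)"])
    show "weak_deriv (\<delta> n) \<in> L2" for n
      using \<delta>(1) by (intro H1_weak_deriv) (simp add: phase_class_def)
    have "(\<lambda>n. E (\<delta> n)) \<longlonglongrightarrow> I"
    proof (rule tendsto_sandwich[of "\<lambda>_. I" _ _ "\<lambda>n. I + inverse (real (Suc n))"])
      show "(\<lambda>n. I + inverse (real (Suc n))) \<longlonglongrightarrow> I"
        using tendsto_add[OF tendsto_const[of I] LIMSEQ_inverse_real_of_nat] by simp
    qed (use I_le \<delta> in \<open>auto intro!: always_eventually less_imp_le\<close>)
    then show "(\<lambda>n. J (weak_deriv (\<delta> n)) (D n)) \<longlonglongrightarrow> I" by (simp add: D)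
  qed (use D in auto)
  then obtain \<delta>' where "\<delta>' \<in> phase_class" "E \<delta>' \<le> I" by (auto simp: E_def)
  with I_le have "is_arg_min (phase_energy m a) (\<lambda>\<delta>. \<delta> \<in> phase_class) \<delta>'"
    unfolding is_arg_min_iff by (auto simp: E_def intro: order_trans)
  then show ?thesis by blast
qed

end

section \<open>The Euler-Lagrange equation\<close>

context phase_setting
begin

lemma s_weak_deriv: "has_weak_deriv s (\<lambda>t. 2 * c t * b t)"
proof -
  obtain A where A: "primitive A b" and ae: "AE t in lebesgue. a t = A t"
    using has_weak_deriv_imp_primitive[OF a_weak_deriv] by blast
  have "primitive (\<lambda>t. sinh (2 * A t)) (\<lambda>t. 2 * cosh (2 * A t) * b t)"
    by (rule primitive_compose[OF A]) (auto intro!: derivative_eq_intros continuous_intros)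
  then have "has_weak_deriv (\<lambda>t. sinh (2 * A t)) (\<lambda>t. 2 * cosh (2 * A t) * b t)"
    by (rule primitive_has_weak_deriv)
  then show ?thesis
  proof (rule has_weak_deriv_cong_AE)
    show "AE t in lebesgue. sinh (2 * A t) = s t"
      using ae by eventually_elim (simp add: s_def)
    show "AE t in lebesgue. 2 * cosh (2 * A t) * b t = 2 * c t * b t"
      using ae by eventually_elim (simp add: c_def)
  qed measurable
qed

definition F :: "(real \<Rightarrow> real) \<Rightarrow> real \<Rightarrow> real" where
  "F d t = 2 * m * b t * c t - 2 * m\<^sup>2 * c t * sin (2 * d t) - 2 * m * b t * cos (2 * d t)"

lemma c_locally_bounded: "\<exists>B. AE t in lebesgue. t \<in> {-R..R} \<longrightarrow> \<bar>c t\<bar> \<le> B"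
proof -
  obtain C where "AE t in lebesgue. c t \<le> C \<and> \<bar>s t\<bar> \<le> C * \<bar>a t\<bar>" using c_bounded by blast
  then have "AE t in lebesgue. t \<in> {-R..R} \<longrightarrow> \<bar>c t\<bar> \<le> C"
  proof eventually_elim
    case (elim t)
    with c_ge_1[of t] show ?case by simp
  qed
  then show ?thesis by blast
qed

lemma locally_integrable_parts:
  shows "locally_integrable b" "locally_integrable c" "locally_integrable (\<lambda>t. b t * c t)"
proof -
  show b: "locally_integrable b" by (rule L2_locally_integrable[OF b_L2])
  have one: "locally_integrable (\<lambda>_. 1)" by (rule continuous_locally_integrable) simp
  show "locally_integrable c"
    using locally_integrable_mult_bounded[OF one c_measurable c_locally_bounded] by simp
  show "locally_integrable (\<lambda>t. b t * c t)"
    by (rule locally_integrable_mult_bounded[OF b c_measurable c_locally_bounded])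
qed

lemma locally_integrable_mult_sin_cos:
  assumes f: "locally_integrable f" and [measurable]: "d \<in> borel_measurable lebesgue"
  shows "locally_integrable (\<lambda>t. f t * sin (2 * d t))" "locally_integrable (\<lambda>t. f t * cos (2 * d t))"
proof -
  show "locally_integrable (\<lambda>t. f t * sin (2 * d t))"
    by (rule locally_integrable_mult_bounded[OF f]) (measurable, auto intro!: exI[of _ 1])
  show "locally_integrable (\<lambda>t. f t * cos (2 * d t))"
    by (rule locally_integrable_mult_bounded[OF f]) (measurable, auto intro!: exI[of _ 1])
qed

lemma F_locally_integrable:
  assumes d: "d \<in> borel_measurable lebesgue"
  shows "locally_integrable (F d)"
proof -
  have "locally_integrable (\<lambda>t. 2 * m * (b t * c t) - 2 * m\<^sup>2 * (c t * sin (2 * d t)) - 2 * m * (b t * cos (2 * d t)))"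
    by (intro locally_integrable_diff locally_integrable_mult locally_integrable_mult_sin_cos
        locally_integrable_parts d)
  then show ?thesis by (simp add: F_def[abs_def] mult.assoc)
qed

text \<open>The strict bound on the norm keeps \<delta> + \<epsilon> \<phi> admissible for small
  \<epsilon> of either sign, so the first variation must vanish and not merely have a sign.\<close>

lemma minimizer_weak_equation:
  assumes min: "is_arg_min (phase_energy m a) (\<lambda>\<delta>. \<delta> \<in> phase_class) \<delta>"
    and small: "Linf_norm \<delta> < ereal (pi / 2)" and \<phi>: "\<phi> \<in> test_functions"
  shows "(LINT t|lebesgue. - (weak_deriv \<delta> t * deriv \<phi> t) + F \<delta> t * \<phi> t) = 0"
proof -
  have H: "\<delta> \<in> H1" and J_min: "\<And>\<eta>. \<eta> \<in> phase_class \<Longrightarrow> J (weak_deriv \<delta>) \<delta> \<le> J (weak_deriv \<eta>) \<eta>"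
    using min unfolding is_arg_min_iff by (auto simp: phase_class_def)
  note w = H1_weak_deriv[OF H]
  note \<phi>L = test_function_L2[OF \<phi>]
  have \<phi>w: "has_weak_deriv \<phi> (deriv \<phi>)"
    by (rule primitive_has_weak_deriv[OF test_function_primitive[OF \<phi>]])
  have \<delta>m [measurable]: "\<delta> \<in> borel_measurable lebesgue" by (rule L2_measurable[OF w(1)])
  have [measurable]: "\<phi> \<in> borel_measurable lebesgue" by (rule L2_measurable[OF \<phi>L(1)])
  obtain r where r: "r < pi / 2" "AE t in lebesgue. \<bar>\<delta> t\<bar> \<le> r"
    using Linf_norm_less[OF small] by blast
  obtain B where B: "B \<ge> 0" "\<And>t. \<bar>\<phi> t\<bar> \<le> B" using test_function_bounded[OF \<phi>] by blast
  \<comment> \<open>The perturbation moves \<delta> by at most pi/2 - r; B + 1 in place of B avoids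
    a zero denominator.\<close>
  define \<epsilon>\<^sub>0 where "\<epsilon>\<^sub>0 = (pi / 2 - r) / (B + 1)"
  have \<epsilon>\<^sub>0: "\<epsilon>\<^sub>0 > 0" "\<epsilon>\<^sub>0 * B \<le> pi / 2 - r"
  proof -
    show "\<epsilon>\<^sub>0 > 0" using r B by (simp add: \<epsilon>\<^sub>0_def)
    then have "\<epsilon>\<^sub>0 * B \<le> \<epsilon>\<^sub>0 * (B + 1)" by (intro mult_left_mono) auto
    then show "\<epsilon>\<^sub>0 * B \<le> pi / 2 - r" using B by (simp add: \<epsilon>\<^sub>0_def)
  qed
  \<comment> \<open>L is the derivative of \<open>pot\<close> in its second argument at \<delta>,
    times \<phi>. Q collects the remainders: with h = 2 \<epsilon> \<phi> the coefficients 2 become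
    8.\<close>
  define L where "L t = 4 * (m\<^sup>2 * c t * sin (2 * \<delta> t) + m * b t * cos (2 * \<delta> t)) * \<phi> t" for t
  define Q where "Q t = 8 * (m\<^sup>2 * c t + m * \<bar>b t\<bar>) * \<phi> t * \<phi> t" for t
  define k where "k t = weak_deriv \<delta> t + m * s t" for t
  have kL: "k \<in> L2" unfolding k_def by (rule kinetic_L2[OF w(2)])
  have int_L: "integrable lebesgue L"
  proof -
    have "locally_integrable (\<lambda>t. 4 * (m\<^sup>2 * (c t * sin (2 * \<delta> t)) + m * (b t * cos (2 * \<delta> t))))"
      by (intro locally_integrable_add locally_integrable_mult locally_integrable_mult_sin_cos
          locally_integrable_parts \<delta>m)
    from integrable_mult_test_function(1)[OF this \<phi>] show ?thesis
      by (simp add: L_def[abs_def] mult.assoc)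
  qed
  have int_Q: "integrable lebesgue Q"
  proof -
    have "locally_integrable (\<lambda>t. 8 * (m\<^sup>2 * c t + m * \<bar>b t\<bar>))"
      by (intro locally_integrable_add locally_integrable_mult locally_integrable_abs
          locally_integrable_parts)
    then have "locally_integrable (\<lambda>t. 8 * (m\<^sup>2 * c t + m * \<bar>b t\<bar>) * \<phi> t)"
      by (rule locally_integrable_mult_continuous[OF _ test_function_DERIV(2)[OF \<phi>]])
    from integrable_mult_test_function(1)[OF this \<phi>] show ?thesis
      by (simp add: Q_def[abs_def])
  qed
  have pot_le: "pot t (\<delta> t + \<epsilon> * \<phi> t) \<le> pot t (\<delta> t) + \<epsilon> * L t + \<epsilon>\<^sup>2 * Q t" for t \<epsilon>
  proof -
    define h where "h = 2 * (\<epsilon> * \<phi> t)"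
    have x: "2 * (\<delta> t + \<epsilon> * \<phi> t) = 2 * \<delta> t + h" by (simp add: h_def)
    note so = sin_cos_second_order[of "2 * \<delta> t" h]
    \<comment> \<open>The cosine remainder has a nonnegative coefficient, so a one-sided bound is
      enough; b has no sign, so the sine remainder is estimated in absolute value.\<close>
    have "- (cos (2 * \<delta> t + h) - cos (2 * \<delta> t) + h * sin (2 * \<delta> t)) \<le> h\<^sup>2"
      using so(1) by linarith
    then have 1: "2 * m\<^sup>2 * c t * - (cos (2 * \<delta> t + h) - cos (2 * \<delta> t) + h * sin (2 * \<delta> t)) \<le> 2 * m\<^sup>2 * c t * h\<^sup>2"
      using c_ge_1[of t] by (intro mult_left_mono) auto
    have "2 * m * b t * (sin (2 * \<delta> t + h) - sin (2 * \<delta> t) - h * cos (2 * \<delta> t))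
        \<le> \<bar>2 * m * b t\<bar> * \<bar>sin (2 * \<delta> t + h) - sin (2 * \<delta> t) - h * cos (2 * \<delta> t)\<bar>"
      by (metis abs_ge_self abs_mult)
    also have "\<dots> \<le> \<bar>2 * m * b t\<bar> * h\<^sup>2" using so(2) by (intro mult_left_mono) auto
    also have "\<bar>2 * m * b t\<bar> = 2 * m * \<bar>b t\<bar>" using m_pos by (simp add: abs_mult)
    finally have 2: "2 * m * b t * (sin (2 * \<delta> t + h) - sin (2 * \<delta> t) - h * cos (2 * \<delta> t)) \<le> 2 * m * \<bar>b t\<bar> * h\<^sup>2" .
    have "pot t (\<delta> t + \<epsilon> * \<phi> t) - pot t (\<delta> t)
        = 2 * m\<^sup>2 * c t * - (cos (2 * \<delta> t + h) - cos (2 * \<delta> t) + h * sin (2 * \<delta> t))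
          + 2 * m * b t * (sin (2 * \<delta> t + h) - sin (2 * \<delta> t) - h * cos (2 * \<delta> t)) + \<epsilon> * L t"
      unfolding pot_eq x by (simp add: L_def h_def algebra_simps)
    also have "\<dots> \<le> 2 * m\<^sup>2 * c t * h\<^sup>2 + 2 * m * \<bar>b t\<bar> * h\<^sup>2 + \<epsilon> * L t"
      using 1 2 by (intro add_mono) auto
    also have "\<dots> = \<epsilon> * L t + \<epsilon>\<^sup>2 * Q t"
      by (simp add: Q_def h_def power2_eq_square algebra_simps)
    finally show ?thesis by simp
  qed
  \<comment> \<open>The left-hand side is the first variation of \<open>J\<close> in the direction
    \<phi>.\<close>
  have "2 * (LINT t|lebesgue. k t * deriv \<phi> t) + (LINT t|lebesgue. L t) = 0"
  proof (rule quadratic_perturbation_zero[OF \<epsilon>\<^sub>0(1)])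
    fix \<epsilon> :: real assume \<epsilon>: "\<bar>\<epsilon>\<bar> \<le> \<epsilon>\<^sub>0"
    define \<eta> where "\<eta> t = \<delta> t + \<epsilon> * \<phi> t" for t
    define g where "g t = weak_deriv \<delta> t + \<epsilon> * deriv \<phi> t" for t
    have \<eta>L: "\<eta> \<in> L2" and gL: "g \<in> L2"
      unfolding \<eta>_def g_def by (intro L2_add L2_cmult w \<phi>L)+
    have \<eta>w: "has_weak_deriv \<eta> g"
      unfolding \<eta>_def g_def by (rule has_weak_deriv_add_mult[OF w(3) \<phi>w])
    note H\<eta> = H1I[OF \<eta>L gL \<eta>w]
    have "AE t in lebesgue. \<bar>\<eta> t\<bar> \<le> pi / 2"
      using r(2)
    proof eventually_elim
      case (elim t)
      have "\<bar>\<epsilon> * \<phi> t\<bar> \<le> \<epsilon>\<^sub>0 * B"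
        unfolding abs_mult using \<epsilon> B by (intro mult_mono) auto
      with elim \<epsilon>\<^sub>0(2) show ?case unfolding \<eta>_def by linarith
    qed
    with H\<eta>(1) have "\<eta> \<in> phase_class" by (simp add: phase_class_def)
    then have "J (weak_deriv \<delta>) \<delta> \<le> J (weak_deriv \<eta>) \<eta>" by (rule J_min)
    also have "\<dots> = J g \<eta>"
      by (rule J_cong[OF H1_weak_deriv(2)[OF H\<eta>(1)] gL \<eta>L \<eta>L H\<eta>(2)]) simp
    finally have le: "J (weak_deriv \<delta>) \<delta> \<le> J g \<eta>" .
    have "(LINT t|lebesgue. (g t + m * s t)\<^sup>2)
        = (LINT t|lebesgue. ((k t)\<^sup>2 + (2 * \<epsilon>) * (k t * deriv \<phi> t)) + \<epsilon>\<^sup>2 * (deriv \<phi> t)\<^sup>2)"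
      by (rule Bochner_Integration.integral_cong) (auto simp: g_def k_def power2_eq_square algebra_simps)
    also have "\<dots> = (LINT t|lebesgue. (k t)\<^sup>2) + (2 * \<epsilon>) * (LINT t|lebesgue. k t * deriv \<phi> t)
        + \<epsilon>\<^sup>2 * (LINT t|lebesgue. (deriv \<phi> t)\<^sup>2)"
      using L2_square_integrable[OF kL] L2_integrable_mult[OF kL \<phi>L(2)] L2_square_integrable[OF \<phi>L(2)]
      by simp
    finally have kin: "(LINT t|lebesgue. (g t + m * s t)\<^sup>2) = (LINT t|lebesgue. (k t)\<^sup>2)
        + (2 * \<epsilon>) * (LINT t|lebesgue. k t * deriv \<phi> t) + \<epsilon>\<^sup>2 * (LINT t|lebesgue. (deriv \<phi> t)\<^sup>2)" .
    have "(LINT t|lebesgue. pot t (\<eta> t)) \<le> (LINT t|lebesgue. pot t (\<delta> t) + \<epsilon> * L t + \<epsilon>\<^sup>2 * Q t)"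
      using pot_integrable[OF \<eta>L] pot_integrable[OF w(1)] int_L int_Q pot_le
      by (intro integral_mono) (auto simp: \<eta>_def)
    also have "\<dots> = (LINT t|lebesgue. pot t (\<delta> t)) + \<epsilon> * (LINT t|lebesgue. L t) + \<epsilon>\<^sup>2 * (LINT t|lebesgue. Q t)"
      using pot_integrable[OF w(1)] int_L int_Q by simp
    finally have "J g \<eta> \<le> J (weak_deriv \<delta>) \<delta>
        + \<epsilon> * (2 * (LINT t|lebesgue. k t * deriv \<phi> t) + (LINT t|lebesgue. L t))
        + \<epsilon>\<^sup>2 * ((LINT t|lebesgue. (deriv \<phi> t)\<^sup>2) + (LINT t|lebesgue. Q t))"
      unfolding J_def kin k_def[symmetric] by (simp add: algebra_simps)
    with le show "0 \<le> \<epsilon> * (2 * (LINT t|lebesgue. k t * deriv \<phi> t) + (LINT t|lebesgue. L t))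
        + \<epsilon>\<^sup>2 * ((LINT t|lebesgue. (deriv \<phi> t)\<^sup>2) + (LINT t|lebesgue. Q t))"
      by simp
  qed
  moreover have "(LINT t|lebesgue. k t * deriv \<phi> t)
      = (LINT t|lebesgue. weak_deriv \<delta> t * deriv \<phi> t) - m * (LINT t|lebesgue. 2 * c t * b t * \<phi> t)"
  proof -
    have "(LINT t|lebesgue. k t * deriv \<phi> t)
        = (LINT t|lebesgue. weak_deriv \<delta> t * deriv \<phi> t + m * (s t * deriv \<phi> t))"
      by (rule Bochner_Integration.integral_cong) (auto simp: k_def algebra_simps)
    also have "\<dots> = (LINT t|lebesgue. weak_deriv \<delta> t * deriv \<phi> t) + m * (LINT t|lebesgue. s t * deriv \<phi> t)"
      using L2_integrable_mult[OF w(2) \<phi>L(2)] L2_integrable_mult[OF s_L2 \<phi>L(2)] by simp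
    also have "(LINT t|lebesgue. s t * deriv \<phi> t) = - (LINT t|lebesgue. 2 * c t * b t * \<phi> t)"
      using s_weak_deriv \<phi> by (simp add: has_weak_deriv_def)
    finally show ?thesis by simp
  qed
  \<comment> \<open>With s integrated by parts, this is -1/2 times the first variation.\<close>
  moreover have "(LINT t|lebesgue. - (weak_deriv \<delta> t * deriv \<phi> t) + F \<delta> t * \<phi> t)
      = - (LINT t|lebesgue. weak_deriv \<delta> t * deriv \<phi> t) + m * (LINT t|lebesgue. 2 * c t * b t * \<phi> t)
        - (1 / 2) * (LINT t|lebesgue. L t)"
  proof -
    have i: "integrable lebesgue (\<lambda>t. 2 * c t * b t * \<phi> t)"
      using s_weak_deriv by (intro integrable_mult_test_function(1)[OF _ \<phi>]) (simp add: has_weak_deriv_def)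
    have "(LINT t|lebesgue. - (weak_deriv \<delta> t * deriv \<phi> t) + F \<delta> t * \<phi> t)
        = (LINT t|lebesgue. (- (weak_deriv \<delta> t * deriv \<phi> t) + m * (2 * c t * b t * \<phi> t)) - (1 / 2) * L t)"
      by (rule Bochner_Integration.integral_cong) (auto simp: F_def L_def algebra_simps)
    also have "\<dots> = - (LINT t|lebesgue. weak_deriv \<delta> t * deriv \<phi> t) + m * (LINT t|lebesgue. 2 * c t * b t * \<phi> t)
        - (1 / 2) * (LINT t|lebesgue. L t)"
      using L2_integrable_mult[OF w(2) \<phi>L(2)] i int_L
      by (simp add: Bochner_Integration.integral_diff Bochner_Integration.integral_add)
    finally show ?thesis .
  qed
  ultimately show ?thesis by simp
qed

lemma minimizer_phase_weak_solution:
  assumes "is_arg_min (phase_energy m a) (\<lambda>\<delta>. \<delta> \<in> phase_class) \<delta>"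
    and "Linf_norm \<delta> < ereal (pi / 2)"
  shows "phase_weak_solution m a \<delta>"
proof -
  have H: "\<delta> \<in> H1" using assms(1) by (simp add: is_arg_min_def phase_class_def)
  have "locally_integrable (F \<delta>)"
    by (rule F_locally_integrable[OF L2_measurable[OF H1_weak_deriv(1)[OF H]]])
  with H1_subset_H1_loc[OF H] minimizer_weak_equation[OF assms] show ?thesis
    by (simp add: phase_weak_solution_def F_def[abs_def] c_def)
qed

lemma zero_not_minimizer:
  assumes "\<not> (AE t in lebesgue. b t * (c t - 1) = 0)"
  shows "\<not> is_arg_min (phase_energy m a) (\<lambda>\<delta>. \<delta> \<in> phase_class) (\<lambda>_. 0)"
proof
  assume min: "is_arg_min (phase_energy m a) (\<lambda>\<delta>. \<delta> \<in> phase_class) (\<lambda>_. 0)"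
  \<comment> \<open>Zero stays away from the constraint, so as a minimizer it would have to satisfy
    the weak equation.\<close>
  have "Linf_norm (\<lambda>_. 0) \<le> 0"
    unfolding Linf_norm_def by (rule esssup_I) auto
  also have "\<dots> < ereal (pi / 2)" by simp
  finally have small: "Linf_norm (\<lambda>_. 0) < ereal (pi / 2)" .
  have "AE t in lebesgue. F (\<lambda>_. 0) t = 0"
  proof (rule test_functions_separate)
    show li: "locally_integrable (F (\<lambda>_. 0))" by (rule F_locally_integrable) simp
    fix \<phi> assume \<phi>: "\<phi> \<in> test_functions"
    note w = H1_weak_deriv[of "\<lambda>_. 0"]
    have "(\<lambda>_. 0) \<in> H1" using zero_in_phase_class by (simp add: phase_class_def)
    then have [measurable]: "weak_deriv (\<lambda>_. 0) \<in> borel_measurable lebesgue"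
      using w(2) L2_measurable by blast
    have [measurable]: "\<phi> \<in> borel_measurable lebesgue" "deriv \<phi> \<in> borel_measurable lebesgue"
      using test_function_L2[OF \<phi>] L2_measurable by blast+
    have [measurable]: "F (\<lambda>_. 0) \<in> borel_measurable lebesgue"
      by (rule locally_integrable_measurable[OF li])
    have "(LINT t|lebesgue. F (\<lambda>_. 0) t * \<phi> t)
        = (LINT t|lebesgue. - (weak_deriv (\<lambda>_. 0) t * deriv \<phi> t) + F (\<lambda>_. 0) t * \<phi> t)"
    proof (rule integral_cong_AE)
      show "AE t in lebesgue. F (\<lambda>_. 0) t * \<phi> t
          = - (weak_deriv (\<lambda>_. 0) t * deriv \<phi> t) + F (\<lambda>_. 0) t * \<phi> t"
        using zero_in_phase_class(2) by eventually_elim simp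
    qed measurable
    also have "\<dots> = 0" by (rule minimizer_weak_equation[OF min small \<phi>])
    finally show "(LINT t|lebesgue. F (\<lambda>_. 0) t * \<phi> t) = 0" .
  qed
  then have "AE t in lebesgue. b t * (c t - 1) = 0"
  proof eventually_elim
    case (elim t)
    then have "2 * m * (b t * (c t - 1)) = 0" by (simp add: F_def algebra_simps)
    with m_pos show ?case by simp
  qed
  with assms show False by simp
qed

lemma minimizer_below_zero:
  assumes nontriv: "\<not> (AE t in lebesgue. b t * (c t - 1) = 0)"
    and min: "is_arg_min (phase_energy m a) (\<lambda>\<delta>. \<delta> \<in> phase_class) \<delta>"
  shows "\<not> (AE t in lebesgue. \<delta> t = 0)" "phase_energy m a \<delta> < phase_energy m a (\<lambda>_. 0)"
proof -
  show lt: "phase_energy m a \<delta> < phase_energy m a (\<lambda>_. 0)"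
  proof (rule ccontr)
    assume "\<not> ?thesis"
    with min have "is_arg_min (phase_energy m a) (\<lambda>\<delta>. \<delta> \<in> phase_class) (\<lambda>_. 0)"
      using zero_in_phase_class(1) unfolding is_arg_min_def by (meson le_less_trans not_less)
    with zero_not_minimizer[OF nontriv] show False by simp
  qed
  \<comment> \<open>A function that vanishes almost everywhere has the same energy as the zero
    function, against the strict inequality just shown.\<close>
  show "\<not> (AE t in lebesgue. \<delta> t = 0)"
  proof
    assume ae: "AE t in lebesgue. \<delta> t = 0"
    have H: "\<delta> \<in> H1" "(\<lambda>_. 0) \<in> H1"
      using min zero_in_phase_class by (auto simp: is_arg_min_def phase_class_def)
    note w = H1_weak_deriv[OF H(1)] and z = H1_weak_deriv[OF H(2)]
    have "AE t in lebesgue. weak_deriv \<delta> t = weak_deriv (\<lambda>_. 0) t"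
      by (rule has_weak_deriv_unique[OF w(3) z(3) ae])
    then have "J (weak_deriv \<delta>) \<delta> = J (weak_deriv (\<lambda>_. 0)) (\<lambda>_. 0)"
      by (rule J_cong[OF w(2) z(2) w(1) z(1) _ ae])
    with lt show False by (simp add: phase_energy_eq_J H)
  qed
qed

end

theorem theorem7p2:
  fixes m :: real and a :: "real \<Rightarrow> real"
  assumes "m > 0"
    and "a \<in> H1 \<inter> Linf"
  shows "(\<exists>\<delta>. is_arg_min (phase_energy m a) (\<lambda>\<delta>. \<delta> \<in> phase_class) \<delta>)
    \<and> (\<not> (AE t in lebesgue. weak_deriv a t * (cosh (2 * a t) - 1) = 0) \<longrightarrow>
         (\<forall>\<delta>. is_arg_min (phase_energy m a) (\<lambda>\<delta>. \<delta> \<in> phase_class) \<delta> \<longrightarrow>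
            \<not> (AE t in lebesgue. \<delta> t = 0) \<and>
            phase_energy m a \<delta> < phase_energy m a (\<lambda>_. 0)))
    \<and> (\<forall>\<delta>. is_arg_min (phase_energy m a) (\<lambda>\<delta>. \<delta> \<in> phase_class) \<delta> \<and>
            Linf_norm \<delta> < ereal (pi / 2) \<longrightarrow>
            phase_weak_solution m a \<delta>)"
proof -
  interpret phase_setting m a
    by unfold_locales (use assms in auto)
  show ?thesis
    using minimizer_exists minimizer_below_zero[unfolded c_def] minimizer_phase_weak_solution by blast
qed

end
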